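(* Let $d\ge2$, $a>0$, and for $N\ge1$ let $G_N(a,t)=\sum_{n=0}^N A_n^+(a)\,t^n$ with $t$-plane zeros $t_1,\dots,t_N$. For $-\pi\le\theta<\phi\le\pi$ let $\alpha_N(\theta,\phi)=\#\{k:\theta<\operatorname{Arg} t_k\le\phi\}$, where $\operatorname{Arg}$ is the principal argument. Then the arguments of the zeros of $G_N(a,t)$ approach a uniform distribution: for any $-\pi\le\theta<\phi\le\pi$ and $\epsilon>0$ there is $N_1$ such that for all $N\ge N_1$, \[ \left|\tfrac1N\alpha_N(\theta,\phi)-\tfrac{1}{2\pi}(\phi-\theta)\right|^2\le\epsilon. \]
   Context: Let $\mathbb{L}^d$ be the $d$-dimensional hypercubic lattice and $\mathbb{L}^d_+$ the half-lattice consisting of vertices with last coordinate $\ge 0$ (and the lattice edges between them); its boundary $\partial\mathbb{L}^d_+$ is the set of vertices with last coordinate $0$. A positive walk is a self-avoiding walk in $\mathbb{L}^d_+$ starting at the origin; its visits are its vertices other than the origin lying in $\partial\mathbb{L}^d_+$. Let $c_n^+(v)$ be the number of positive walks of length $n$ with exactly $v$ visits, and $A_n^+(a)=\sum_{v=0}^n c_n^+(v)a^v$. For $a>0$ the limit $\lim_{n\to\infty}\frac1n\log A_n^+(a)$ exists. *)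

theory Defs
  imports "HOL-Complex_Analysis.Complex_Analysis" "HOL-Computational_Algebra.Computational_Algebra"
begin

text \<open>Vertices of the d-dimensional hypercubic lattice are integer lists of length d.
  The last coordinate is the entry at index d - 1.\<close>

definition lattice_adj :: "nat \<Rightarrow> int list \<Rightarrow> int list \<Rightarrow> bool" where
  "lattice_adj d x y \<longleftrightarrow> length x = d \<and> length y = d \<and>
     (\<exists>i<d. \<bar>x ! i - y ! i\<bar> = 1 \<and> (\<forall>j<d. j \<noteq> i \<longrightarrow> x ! j = y ! j))"

definition in_half_lattice :: "nat \<Rightarrow> int list \<Rightarrow> bool" where
  "in_half_lattice d x \<longleftrightarrow> length x = d \<and> x ! (d - 1) \<ge> 0"

definition on_boundary :: "nat \<Rightarrow> int list \<Rightarrow> bool" where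
  "on_boundary d x \<longleftrightarrow> length x = d \<and> x ! (d - 1) = 0"

definition positive_walk :: "nat \<Rightarrow> nat \<Rightarrow> int list list \<Rightarrow> bool" where
  "positive_walk d n w \<longleftrightarrow> length w = n + 1 \<and> w ! 0 = replicate d 0 \<and> distinct w \<and>
     (\<forall>i\<le>n. in_half_lattice d (w ! i)) \<and>
     (\<forall>i<n. lattice_adj d (w ! i) (w ! Suc i))"

definition visits :: "nat \<Rightarrow> int list list \<Rightarrow> nat" where
  "visits d w = card {i. 1 \<le> i \<and> i < length w \<and> on_boundary d (w ! i)}"

definition c_plus :: "nat \<Rightarrow> nat \<Rightarrow> nat \<Rightarrow> nat" where
  "c_plus d n v = card {w. positive_walk d n w \<and> visits d w = v}"

definition A_plus :: "nat \<Rightarrow> nat \<Rightarrow> real \<Rightarrow> real" where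
  "A_plus d n a = (\<Sum>v=0..n. real (c_plus d n v) * a ^ v)"

definition G_poly :: "nat \<Rightarrow> real \<Rightarrow> nat \<Rightarrow> complex poly" where
  "G_poly d a N = (\<Sum>n\<le>N. monom (complex_of_real (A_plus d n a)) n)"

definition alpha_count :: "nat \<Rightarrow> real \<Rightarrow> nat \<Rightarrow> real \<Rightarrow> real \<Rightarrow> nat" where
  "alpha_count d a N \<theta> \<phi> = size (filter_mset (\<lambda>z. \<theta> < Arg z \<and> Arg z \<le> \<phi>) (proots (G_poly d a N)))"

end

theory Submission
  imports Defs "HOL-Real_Asymp.Real_Asymp"
begin

text \<open>The zeros of $\sum_{n \le N} b_n t^n$ with $b_n > 0$ have asymptotically uniform arguments as
  soon as $b_n^{1/n}$ converges (Erdos-Turan): on the circle of radius $1/\lim b_n^{1/n}$ the polynomial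
  is $e^{o(N)}$ times the geometric mean of its extreme terms. Moving the zeros radially to
  $\zeta_i = t_i / |t_i|$ turns this into $\prod_i |u - \zeta_i| \le e^{o(N)}$ for $|u| = 1$, and the
  Borel-Caratheodory inequality for $\sum_i \log (1 - \zeta_i z)$ bounds its Taylor coefficients, which
  are the power sums of the $\zeta_i$, by $o(N)$. Weyl's criterion finishes the argument.

  That $A_n^+(a)^{1/n}$ converges is the Hammersley-Welsh argument carried out parallel to the
  boundary: a walk is unfolded in its first coordinate by reflecting it at $O(\sqrt n)$ times, which
  keeps all heights and hence all visits and loses only a factor $e^{o(n)}$. Two unfolded walks ending
  at the same height can be joined, one of them backwards, to an unfolded walk that ends on the
  boundary. So the unfolded walks ending on the boundary are supermultiplicative and have the same
  growth rate as all positive walks.\<close>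

section \<open>Unfolding a walk in one coordinate\<close>

text \<open>Since d >= 2, the first coordinate is not the height, so its reflections disturb neither
  the half-space nor the visits. Unfolding cannot control the final height, and the joining needs
  equal final heights. Therefore each height h is treated separately: joining its class to itself
  bounds the square of its weight by the weight of walks of length 2 n + 1 that end on the boundary,
  and the n + 1 possible heights cost only a polynomial factor. On the analytic side the available
  bound on the product over the circle is one from above, that is, a one-sided bound on the real
  part of a logarithm; Borel-Caratheodory turns it into bounds for the moduli of the coefficients.
  Positivity of the coefficients bounds the polynomial on |t| = R by its value at R and keeps the
  zeros away from 0. No rate is tracked: convergence of the growth rate gives o(N) only.\<close>

definition sign_changes :: "(nat \<Rightarrow> int) \<Rightarrow> nat \<Rightarrow> nat set" where
  "sign_changes s n = {i. Suc i < n \<and> s i \<noteq> s (Suc i)}"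

text \<open>\<open>y\<close> stands for all other coordinates, which reflections leave alone; its
  type is arbitrary, as only equality matters. The signs \<open>s\<close> record which steps are
  mirrored, so that \<open>x\<close> can be recovered from \<open>x'\<close>, \<open>s\<close> and
  its starting value.\<close>

definition unfolding_of ::
    "(nat \<Rightarrow> int) \<Rightarrow> (nat \<Rightarrow> 'b) \<Rightarrow> nat \<Rightarrow> (nat \<Rightarrow> int) \<Rightarrow> (nat \<Rightarrow> int) \<Rightarrow> bool" where
  "unfolding_of x y n x' s \<longleftrightarrow>
     (\<forall>i<n. (s i = 1 \<or> s i = -1) \<and> x' (Suc i) - x' i = s i * (x (Suc i) - x i)) \<and>
     inj_on (\<lambda>i. (x' i, y i)) {..n} \<and> (\<forall>i\<le>n. x' i \<le> x' n)"

lemma finite_sign_changes [simp]: "finite (sign_changes s n)"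
  by (rule finite_subset[of _ "{..<n}"]) (auto simp: sign_changes_def)

text \<open>Besides the changes inside the two pieces there can be one at the seam
  \<open>m - 1\<close>. The map \<open>f\<close> allows the first piece to be indexed differently,
  as when it is traversed backwards.\<close>

lemma card_sign_changes_append_le:
  assumes "\<And>i. Suc i < m \<Longrightarrow> s i \<noteq> s (Suc i) \<Longrightarrow> f i \<in> sign_changes s1 m"
    and "inj_on f {i. Suc i < m}"
    and "\<And>i. Suc i < n - m \<Longrightarrow> s (m + i) \<noteq> s (m + Suc i) \<Longrightarrow> i \<in> sign_changes s2 (n - m)"
  shows "card (sign_changes s n) \<le> card (sign_changes s1 m) + 1 + card (sign_changes s2 (n - m))"
proof -
  define A where "A = {i. Suc i < m \<and> s i \<noteq> s (Suc i)}"
  have A: "card A \<le> card (sign_changes s1 m)"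
    by (rule card_inj_on_le[of f])
      (use assms(1,2) in \<open>auto simp: A_def intro: inj_on_subset\<close>)
  have "sign_changes s n \<subseteq> A \<union> {m - 1} \<union> (+) m ` sign_changes s2 (n - m)"
  proof
    fix i assume i: "i \<in> sign_changes s n"
    consider "Suc i < m" | "i = m - 1" | "m \<le> i" by linarith
    then show "i \<in> A \<union> {m - 1} \<union> (+) m ` sign_changes s2 (n - m)"
    proof cases
      case 3
      then obtain j where "i = m + j" using le_Suc_ex by blast
      then show ?thesis using i assms(3)[of j] by (auto simp: sign_changes_def)
    qed (use i in \<open>auto simp: A_def sign_changes_def\<close>)
  qed
  moreover have "finite A"
    by (rule finite_subset[of _ "{..<m}"]) (auto simp: A_def)
  ultimately have "card (sign_changes s n) \<le> card (A \<union> {m - 1} \<union> (+) m ` sign_changes s2 (n - m))"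
    by (intro card_mono) auto
  also have "\<dots> \<le> card A + 1 + card ((+) m ` sign_changes s2 (n - m))"
    using card_Un_le[of "A \<union> {m - 1}" "(+) m ` sign_changes s2 (n - m)"] card_Un_le[of A "{m-1}"]
    by simp
  also have "card ((+) m ` sign_changes s2 (n - m)) \<le> card (sign_changes s2 (n - m))"
    by (rule card_image_le) simp
  finally show ?thesis using A by linarith
qed

text \<open>Taking the last maximum, not just any, makes the remainder strictly lower; its mirror
  image is then strictly higher than the cut and cannot meet what came before.\<close>

lemma exists_last_maximum:
  fixes x :: "nat \<Rightarrow> int"
  shows "\<exists>m\<le>n. (\<forall>i\<le>n. x i \<le> x m) \<and> (\<forall>i. m < i \<and> i \<le> n \<longrightarrow> x i < x m)"
proof (induction n)
  case (Suc n)
  then obtain m where m: "m \<le> n" "\<forall>i\<le>n. x i \<le> x m" "\<forall>i. m < i \<and> i \<le> n \<longrightarrow> x i < x m" by blast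
  show ?case
  proof (cases "x (Suc n) < x m")
    case True
    then show ?thesis using m by (intro exI[of _ m]) (auto simp: le_Suc_eq)
  next
    case False
    then have "x i \<le> x (Suc n)" if "i \<le> n" for i
      using m(2) that by (meson linorder_not_less order_trans)
    then show ?thesis by (intro exI[of _ "Suc n"]) (auto simp: le_Suc_eq)
  qed
qed simp

lemma unfolding_of_refl:
  assumes "inj_on (\<lambda>i. (x i, y i)) {..n}" "\<forall>i\<le>n. x i \<le> x n"
  shows "unfolding_of x y n x (\<lambda>_. 1)"
  using assms by (auto simp: unfolding_of_def)

text \<open>The remainder after time \<open>m\<close> is mirrored in the level \<open>x m\<close>
  and then unfolded as \<open>r\<close>. The first piece stays at or below that level and the rest
  strictly above it, so the two cannot collide. Mirroring negates the signs and adds at most one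
  change, at the seam.\<close>

lemma unfolding_of_splice:
  assumes inj: "inj_on (\<lambda>i. (x i, y i)) {..n}" and "m < n" and max: "\<forall>i\<le>m. x i \<le> x m"
    and r: "unfolding_of (\<lambda>i. 2 * x m - x (m + i)) (\<lambda>i. y (m + i)) (n - m) r s'"
    and r0: "r 0 = x m" "\<forall>i. 0 < i \<and> i \<le> n - m \<longrightarrow> x m < r i"
  defines "x' \<equiv> \<lambda>i. if i \<le> m then x i else r (i - m)"
    and "s \<equiv> \<lambda>i. if i < m then 1 else - s' (i - m)"
  shows "unfolding_of x y n x' s"
    and "card (sign_changes s n) \<le> card (sign_changes s' (n - m)) + 1"
proof -
  have r': "s' i = 1 \<or> s' i = -1" "r (Suc i) - r i = s' i * (x (m + i) - x (m + Suc i))"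
    if "i < n - m" for i
    using r that by (auto simp: unfolding_of_def)
  have inj_r: "inj_on (\<lambda>i. (r i, y (m + i))) {..n - m}" and le_r: "\<forall>i\<le>n-m. r i \<le> r (n - m)"
    using r by (auto simp: unfolding_of_def)
  have x'_ge: "x' i = r (i - m)" if "m \<le> i" for i
    using that r0(1) by (cases "i = m") (auto simp: x'_def)
  show "unfolding_of x y n x' s"
    unfolding unfolding_of_def
  proof (intro conjI allI impI)
    fix i assume i: "i < n"
    show "s i = 1 \<or> s i = -1" using r'(1)[of "i - m"] i by (auto simp: s_def)
    show "x' (Suc i) - x' i = s i * (x (Suc i) - x i)"
    proof (cases "i < m")
      case False
      then obtain j where j: "i = m + j" using le_Suc_ex linorder_not_less by blast
      then show ?thesis
        using r'(2)[of j] i x'_ge[of i] x'_ge[of "Suc i"] by (simp add: s_def algebra_simps)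
    qed (simp add: x'_def s_def)
  next
    show "inj_on (\<lambda>i. (x' i, y i)) {..n}"
    proof (rule linorder_inj_onI')
      fix i j assume ij: "i \<in> {..n}" "j \<in> {..n}" "i < j"
      consider "j \<le> m" | "i \<le> m" "m < j" | "m < i" using ij by linarith
      then show "(x' i, y i) \<noteq> (x' j, y j)"
      proof cases
        case 1
        then show ?thesis using inj_onD[OF inj, of i j] ij by (auto simp: x'_def)
      next
        case 2
        then have "x i \<le> x m" "x m < r (j - m)" using max r0(2) ij by auto
        then show ?thesis using 2 by (auto simp: x'_def)
      next
        case 3
        then have "i - m \<noteq> j - m" "i - m \<le> n - m" "j - m \<le> n - m" using ij by auto
        then show ?thesis using 3 inj_onD[OF inj_r, of "i - m" "j - m"] ij
          by (auto simp: x'_def)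
      qed
    qed
  next
    fix i assume i: "i \<le> n"
    have "x m < r (n - m)" using r0(2) \<open>m < n\<close> by simp
    then show "x' i \<le> x' n"
      using max[rule_format, of i] le_r[rule_format, of "i - m"] i \<open>m < n\<close> by (auto simp: x'_def)
  qed
  show "card (sign_changes s n) \<le> card (sign_changes s' (n - m)) + 1"
    using card_sign_changes_append_le[of m s "\<lambda>i. i" "\<lambda>_. 1" n s']
    by (simp add: s_def sign_changes_def)
qed

text \<open>The spans of the successive bridges into which the walk is cut strictly decrease, so
  $c$ cuts cost at least $1 + 2 + \cdots + (c + 1)$ steps.\<close>

lemma unfold_strict_half_space:
  fixes x :: "nat \<Rightarrow> int" and y :: "nat \<Rightarrow> 'b"
  assumes "0 < n" and "inj_on (\<lambda>i. (x i, y i)) {..n}"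
    and "\<forall>i. 0 < i \<and> i \<le> n \<longrightarrow> x 0 < x i" and "\<forall>i<n. \<bar>x (Suc i) - x i\<bar> \<le> 1"
  shows "\<exists>x' s. unfolding_of x y n x' s \<and> x' 0 = x 0 \<and> (\<forall>i. 0 < i \<and> i \<le> n \<longrightarrow> x 0 < x' i) \<and>
     (\<exists>i\<le>n. int (card (sign_changes s n)) + 1 \<le> x i - x 0) \<and>
     (card (sign_changes s n) + 1) * (card (sign_changes s n) + 2) \<le> 2 * n"
  using assms
proof (induction n arbitrary: x y rule: less_induct)
  case (less n)
  obtain m where m: "m \<le> n" "\<forall>i\<le>n. x i \<le> x m" "\<forall>i. m < i \<and> i \<le> n \<longrightarrow> x i < x m"
    using exists_last_maximum[of n x] by blast
  have "x 0 < x n" "x n \<le> x m" using less.prems m by auto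
  then have "0 < m" by (cases m) auto
  have span: "x i - x 0 \<le> int i" if "i \<le> n" for i
    using that
  proof (induction i)
    case (Suc i)
    then show ?case using less.prems(4)[rule_format, of i] by auto
  qed simp
  show ?case
  proof (cases "m = n")
    case True
    have "unfolding_of x y n x (\<lambda>_. 1)"
      using unfolding_of_refl less.prems(2) m(2) True by blast
    moreover have "\<exists>i\<le>n. 1 \<le> x i - x 0" using less.prems(1,3) \<open>x 0 < x n\<close> by (intro exI[of _ n]) auto
    ultimately show ?thesis using less.prems
      by (intro exI[of _ x] exI[of _ "\<lambda>_. 1"]) (auto simp: sign_changes_def)
  next
    case False
    define r where "r = (\<lambda>i. 2 * x m - x (m + i))"
    have "m < n" using m(1) False by simp
    have "inj_on (\<lambda>i. (r i, y (m + i))) {..n - m}"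
    proof (rule inj_onI)
      fix i j assume "i \<in> {..n - m}" "j \<in> {..n - m}" "(r i, y (m + i)) = (r j, y (m + j))"
      then show "i = j"
        using inj_onD[OF less.prems(2), of "m + i" "m + j"] \<open>m < n\<close> by (auto simp: r_def)
    qed
    moreover have "\<forall>i. 0 < i \<and> i \<le> n - m \<longrightarrow> r 0 < r i" using m(3) by (auto simp: r_def)
    moreover have "\<forall>i<n - m. \<bar>r (Suc i) - r i\<bar> \<le> 1"
      using less.prems(4) by (auto simp: r_def abs_minus_commute)
    ultimately obtain r' s' where r': "unfolding_of r (\<lambda>i. y (m + i)) (n - m) r' s'" "r' 0 = r 0"
        "\<forall>i. 0 < i \<and> i \<le> n - m \<longrightarrow> r 0 < r' i"
      and c: "\<exists>i\<le>n - m. int (card (sign_changes s' (n - m))) + 1 \<le> r i - r 0"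
        "(card (sign_changes s' (n - m)) + 1) * (card (sign_changes s' (n - m)) + 2) \<le> 2 * (n - m)"
      using less.IH[of "n - m" r "\<lambda>i. y (m + i)"] \<open>0 < m\<close> \<open>m < n\<close> by auto
    have rm: "r 0 = x m" by (simp add: r_def)
    define x' where "x' = (\<lambda>i. if i \<le> m then x i else r' (i - m))"
    define s where "s = (\<lambda>i. if i < m then 1 else - s' (i - m))"
    have max: "\<forall>i\<le>m. x i \<le> x m" using m by simp
    have U: "unfolding_of x y n x' s" "card (sign_changes s n) \<le> card (sign_changes s' (n - m)) + 1"
      using unfolding_of_splice[OF less.prems(2) \<open>m < n\<close> max r'(1)[unfolded r_def]] r'(2,3)
      unfolding x'_def s_def rm by blast+
    \<comment> \<open>Let c' be the number of sign changes of \<open>s'\<close>. The mirrored rest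
      climbs at least c' + 1 at time \<open>i\<close>, so \<open>x\<close> falls that far below
      \<open>x m\<close> and is still strictly above \<open>x 0\<close>. The first bridge therefore
      spans at least c' + 2.\<close>
    obtain i where i: "i \<le> n - m" "int (card (sign_changes s' (n - m))) + 1 \<le> r i - r 0"
      using c by blast
    have "0 < i" using i by (cases i) auto
    then have "x 0 < x (m + i)" using less.prems(3) i \<open>m < n\<close> by auto
    then have A: "int (card (sign_changes s n)) + 1 \<le> x m - x 0"
      using i(2) U(2) by (auto simp: r_def)
    then have "card (sign_changes s n) + 1 \<le> m" using span[OF m(1)] by linarith
    \<comment> \<open>With c sign changes, this is added to 2 (c + 1) <= 2 m, which holds because
      steps have size at most 1; the left sides add up to (c + 1) (c + 2).\<close>
    moreover have "(card (sign_changes s n) + 1) * card (sign_changes s n) \<le> 2 * (n - m)"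
    proof (cases "card (sign_changes s n)")
      case (Suc k)
      then have "k \<le> card (sign_changes s' (n - m))" using U(2) by simp
      then have "(k + 1) * (k + 2) \<le> 2 * (n - m)"
        using c(2) by (meson add_le_mono1 mult_le_mono order_trans)
      then show ?thesis using Suc by (simp add: algebra_simps)
    qed simp
    ultimately have "(card (sign_changes s n) + 1) * (card (sign_changes s n) + 2) \<le> 2 * n"
      using \<open>m < n\<close> by (simp add: algebra_simps)
    moreover have "\<forall>i. 0 < i \<and> i \<le> n \<longrightarrow> x 0 < x' i"
    proof (intro allI impI)
      fix i assume i: "0 < i \<and> i \<le> n"
      have "r 0 < r' (i - m)" if "m < i" using r'(3) that i by auto
      then show "x 0 < x' i"
        using i less.prems(3)[rule_format, of i] \<open>x 0 < x n\<close> \<open>x n \<le> x m\<close> rm by (auto simp: x'_def)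
    qed
    moreover have "x' 0 = x 0" by (simp add: x'_def)
    ultimately show ?thesis using U(1) A m(1) by blast
  qed
qed

text \<open>Here the walk may return to its starting level. After the cut at the last maximum the
  mirrored remainder is strictly above its start, so \<open>unfold_strict_half_space\<close> applies
  to it; the price is one additional sign change, hence the weaker product.\<close>

lemma unfold_half_space:
  fixes x :: "nat \<Rightarrow> int" and y :: "nat \<Rightarrow> 'b"
  assumes inj: "inj_on (\<lambda>i. (x i, y i)) {..n}"
    and ge: "\<forall>i\<le>n. x 0 \<le> x i" and step: "\<forall>i<n. \<bar>x (Suc i) - x i\<bar> \<le> 1"
  shows "\<exists>x' s. unfolding_of x y n x' s \<and> x' 0 = x 0 \<and> (\<forall>i\<le>n. x 0 \<le> x' i) \<and>
     card (sign_changes s n) * (card (sign_changes s n) + 1) \<le> 2 * n"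
proof -
  obtain m where m: "m \<le> n" "\<forall>i\<le>n. x i \<le> x m" "\<forall>i. m < i \<and> i \<le> n \<longrightarrow> x i < x m"
    using exists_last_maximum[of n x] by blast
  show ?thesis
  proof (cases "m = n")
    case True
    then show ?thesis using unfolding_of_refl[OF inj] m(2) ge
      by (intro exI[of _ x] exI[of _ "\<lambda>_. 1"]) (auto simp: sign_changes_def)
  next
    case False
    define r where "r = (\<lambda>i. 2 * x m - x (m + i))"
    have "m < n" using m(1) False by simp
    have "inj_on (\<lambda>i. (r i, y (m + i))) {..n - m}"
    proof (rule inj_onI)
      fix i j assume "i \<in> {..n - m}" "j \<in> {..n - m}" "(r i, y (m + i)) = (r j, y (m + j))"
      then show "i = j" using inj_onD[OF inj, of "m + i" "m + j"] \<open>m < n\<close> by (auto simp: r_def)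
    qed
    moreover have "\<forall>i. 0 < i \<and> i \<le> n - m \<longrightarrow> r 0 < r i" using m(3) by (auto simp: r_def)
    moreover have "\<forall>i<n - m. \<bar>r (Suc i) - r i\<bar> \<le> 1"
      using step by (auto simp: r_def abs_minus_commute)
    ultimately obtain r' s' where r': "unfolding_of r (\<lambda>i. y (m + i)) (n - m) r' s'" "r' 0 = r 0"
        "\<forall>i. 0 < i \<and> i \<le> n - m \<longrightarrow> r 0 < r' i"
      and c: "(card (sign_changes s' (n - m)) + 1) * (card (sign_changes s' (n - m)) + 2) \<le> 2 * (n - m)"
      using unfold_strict_half_space[of "n - m" r "\<lambda>i. y (m + i)"] \<open>m < n\<close> by auto
    have rm: "r 0 = x m" by (simp add: r_def)
    define x' where "x' = (\<lambda>i. if i \<le> m then x i else r' (i - m))"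
    define s where "s = (\<lambda>i. if i < m then 1 else - s' (i - m))"
    have max: "\<forall>i\<le>m. x i \<le> x m" using m by simp
    have U: "unfolding_of x y n x' s" "card (sign_changes s n) \<le> card (sign_changes s' (n - m)) + 1"
      using unfolding_of_splice[OF inj \<open>m < n\<close> max r'(1)[unfolded r_def]] r'(2,3)
      unfolding x'_def s_def rm by blast+
    have "card (sign_changes s n) * (card (sign_changes s n) + 1)
        \<le> (card (sign_changes s' (n - m)) + 1) * (card (sign_changes s' (n - m)) + 2)"
      using U(2) by (intro mult_le_mono) auto
    then have "card (sign_changes s n) * (card (sign_changes s n) + 1) \<le> 2 * n" using c by linarith
    moreover have "\<forall>i\<le>n. x 0 \<le> x' i"
    proof (intro allI impI)
      fix i assume i: "i \<le> n"
      have "r 0 < r' (i - m)" if "m < i" using r'(3) that i by auto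
      then show "x 0 \<le> x' i"
        using i ge[rule_format, of i] ge[rule_format, of m] rm m(1) by (auto simp: x'_def)
    qed
    moreover have "x' 0 = x 0" by (simp add: x'_def)
    ultimately show ?thesis using U(1) by blast
  qed
qed

text \<open>The walk is cut at its last minimum. Read backwards, the earlier piece stays weakly
  above that level; the later piece stays strictly above it. Each is unfolded, and the earlier one
  is then mirrored below the level, so that the pieces share only the cut vertex. Each contributes
  at most sqrt (2 n) sign changes, the seam one more.\<close>

lemma unfold_walk:
  fixes x :: "nat \<Rightarrow> int" and y :: "nat \<Rightarrow> 'b"
  assumes inj: "inj_on (\<lambda>i. (x i, y i)) {..n}" and step: "\<forall>i<n. \<bar>x (Suc i) - x i\<bar> \<le> 1"
  shows "\<exists>x' s. unfolding_of x y n x' s \<and> x' 0 = 0 \<and> (\<forall>i\<le>n. 0 \<le> x' i) \<and>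
     real (card (sign_changes s n)) \<le> 2 * sqrt (2 * n) + 1"
proof -
  obtain m where m: "m \<le> n" "\<forall>i\<le>n. x m \<le> x i" "\<forall>i. m < i \<and> i \<le> n \<longrightarrow> x m < x i"
    using exists_last_maximum[of n "\<lambda>i. - x i"] by auto
  define p where "p = (\<lambda>i. x (m - i))"
  define q where "q = (\<lambda>i. x (m + i))"
  have pq: "p 0 = x m" "q 0 = x m" by (auto simp: p_def q_def)
  have "inj_on (\<lambda>i. (p i, y (m - i))) {..m}"
  proof (rule inj_onI)
    fix i j assume "i \<in> {..m}" "j \<in> {..m}" "(p i, y (m - i)) = (p j, y (m - j))"
    then have "m - i = m - j" "i \<le> m" "j \<le> m"
      using inj_onD[OF inj, of "m - i" "m - j"] m(1) by (auto simp: p_def)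
    then show "i = j" by linarith
  qed
  moreover have "\<forall>i<m. \<bar>p (Suc i) - p i\<bar> \<le> 1"
  proof (intro allI impI)
    fix i assume "i < m"
    then show "\<bar>p (Suc i) - p i\<bar> \<le> 1"
      using step[rule_format, of "m - Suc i"] m(1) by (simp add: p_def Suc_diff_Suc abs_minus_commute)
  qed
  moreover have "\<forall>i\<le>m. p 0 \<le> p i" using m by (auto simp: p_def)
  ultimately obtain p' s where p': "unfolding_of p (\<lambda>i. y (m - i)) m p' s" "p' 0 = x m"
    "\<forall>i\<le>m. x m \<le> p' i" "card (sign_changes s m) * (card (sign_changes s m) + 1) \<le> 2 * m"
    using unfold_half_space[of p "\<lambda>i. y (m - i)" m] pq by metis
  have inj_q: "inj_on (\<lambda>i. (q i, y (m + i))) {..n - m}"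
  proof (rule inj_onI)
    fix i j assume "i \<in> {..n - m}" "j \<in> {..n - m}" "(q i, y (m + i)) = (q j, y (m + j))"
    then show "i = j" using inj_onD[OF inj, of "m + i" "m + j"] m(1) by (auto simp: q_def)
  qed
  have "\<exists>q' t. unfolding_of q (\<lambda>i. y (m + i)) (n - m) q' t \<and> q' 0 = x m \<and>
      (\<forall>i. 0 < i \<and> i \<le> n - m \<longrightarrow> x m < q' i) \<and>
      card (sign_changes t (n - m)) * (card (sign_changes t (n - m)) + 1) \<le> 2 * (n - m)"
  proof (cases "m = n")
    case True
    then show ?thesis using unfolding_of_refl[OF inj_q] pq
      by (intro exI[of _ q] exI[of _ "\<lambda>_. 1"]) (auto simp: sign_changes_def)
  next
    case False
    moreover have "\<forall>i. 0 < i \<and> i \<le> n - m \<longrightarrow> q 0 < q i" "\<forall>i<n - m. \<bar>q (Suc i) - q i\<bar> \<le> 1"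
      using m(3) step by (auto simp: q_def)
    ultimately obtain q' t where q': "unfolding_of q (\<lambda>i. y (m + i)) (n - m) q' t" "q' 0 = q 0"
       "\<forall>i. 0 < i \<and> i \<le> n - m \<longrightarrow> q 0 < q' i"
       "(card (sign_changes t (n - m)) + 1) * (card (sign_changes t (n - m)) + 2) \<le> 2 * (n - m)"
      using unfold_strict_half_space[OF _ inj_q] m(1) by auto
    then show ?thesis unfolding pq
      by (intro exI[of _ q'] exI[of _ t]) (auto simp: algebra_simps)
  qed
  then obtain q' t where q': "unfolding_of q (\<lambda>i. y (m + i)) (n - m) q' t" "q' 0 = x m"
     "\<forall>i. 0 < i \<and> i \<le> n - m \<longrightarrow> x m < q' i"
     "card (sign_changes t (n - m)) * (card (sign_changes t (n - m)) + 1) \<le> 2 * (n - m)"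
    by blast
  \<comment> \<open>Reversal turns the end of \<open>p'\<close>, its maximum, into the start of
    \<open>w\<close>; mirroring makes this start the minimum, and the final shift by
    \<open>w 0\<close> moves it to 0.\<close>
  define w where "w = (\<lambda>i. (if i \<le> m then 2 * x m - p' (m - i) else q' (i - m)))"
  define u where "u = (\<lambda>i. if i < m then - s (m - Suc i) else t (i - m))"
  have w_ge: "w i = q' (i - m)" if "m \<le> i" for i
    using that q'(2) p'(2) by (cases "i = m") (auto simp: w_def)
  have w_low: "w i \<le> x m" if "i \<le> m" for i using p'(3) that by (auto simp: w_def)
  have w_high: "x m < w i" if "m < i" "i \<le> n" for i using q'(3) that by (auto simp: w_def)
  have q'_le: "q' i \<le> q' (n - m)" if "i \<le> n - m" for i using q'(1) that by (auto simp: unfolding_of_def)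
  have p'_le: "p' i \<le> p' m" if "i \<le> m" for i using p'(1) that by (auto simp: unfolding_of_def)
  have w_le: "w i \<le> w n" if "i \<le> n" for i
  proof (cases "m < i")
    case True
    then show ?thesis using q'_le that by (auto simp: w_def)
  next
    case False
    then have "w i \<le> x m" using w_low by simp
    also have "x m = w m" using w_ge[of m] q'(2) by simp
    also have "\<dots> \<le> w n" using w_ge[of m] w_ge[of n] q'_le[of 0] m(1) by simp
    finally show ?thesis .
  qed
  have "u i = 1 \<or> u i = -1" "w (Suc i) - w i = u i * (x (Suc i) - x i)" if "i < n" for i
  proof -
    have "(u i = 1 \<or> u i = -1) \<and> w (Suc i) - w i = u i * (x (Suc i) - x i)"
    proof (cases "i < m")
      case True
      then have "s (m - Suc i) = 1 \<or> s (m - Suc i) = -1"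
          "p' (m - i) - p' (m - Suc i) = s (m - Suc i) * (x i - x (Suc i))"
        using p'(1) unfolding unfolding_of_def p_def
        by (auto dest!: spec[of _ "m - Suc i"] simp: Suc_diff_Suc)
      then show ?thesis using True by (auto simp: w_def u_def algebra_simps)
    next
      case False
      then have "(t (i - m) = 1 \<or> t (i - m) = -1) \<and>
          q' (Suc (i - m)) - q' (i - m) = t (i - m) * (x (Suc i) - x i)"
        using q'(1) that unfolding unfolding_of_def q_def by auto
      then show ?thesis using False w_ge[of i] w_ge[of "Suc i"]
        by (auto simp: u_def Suc_diff_le)
    qed
    then show "u i = 1 \<or> u i = -1" "w (Suc i) - w i = u i * (x (Suc i) - x i)" by auto
  qed
  moreover have "inj_on (\<lambda>i. (w i, y i)) {..n}"
  proof (rule linorder_inj_onI')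
    fix i j assume ij: "i \<in> {..n}" "j \<in> {..n}" "i < j"
    consider "j \<le> m" | "i \<le> m" "m < j" | "m < i" using ij by linarith
    then show "(w i, y i) \<noteq> (w j, y j)"
    proof cases
      case 1
      have "inj_on (\<lambda>i. (p' i, y (m - i))) {..m}" using p'(1) by (simp add: unfolding_of_def)
      moreover have "m - i \<noteq> m - j" using 1 ij by linarith
      ultimately show ?thesis using inj_onD[of _ _ "m - i" "m - j"] 1 ij by (fastforce simp: w_def)
    next
      case 2
      then show ?thesis using w_low[of i] w_high[of j] ij by auto
    next
      case 3
      have "inj_on (\<lambda>i. (q' i, y (m + i))) {..n - m}" using q'(1) by (simp add: unfolding_of_def)
      moreover have "i - m \<noteq> j - m" using 3 ij by linarith
      ultimately show ?thesis using inj_onD[of _ _ "i - m" "j - m"] 3 ij by (fastforce simp: w_def)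
    qed
  qed
  ultimately have U: "unfolding_of x y n (\<lambda>i. w i - w 0) u"
    using w_le by (auto simp: unfolding_of_def inj_on_def)
  have pos: "w 0 \<le> w i" if "i \<le> n" for i
  proof (cases "i \<le> m")
    case True
    then show ?thesis using p'_le by (auto simp: w_def)
  next
    case False
    then show ?thesis using w_low[of 0] w_high[of i] that by auto
  qed
  have sq: "real c \<le> sqrt (2 * n)" if "c * (c + 1) \<le> 2 * k" "k \<le> n" for c k :: nat
  proof (rule real_le_rsqrt)
    have "c * c \<le> 2 * n" using that by (simp add: algebra_simps)
    then have "real (c * c) \<le> real (2 * n)" by (simp only: of_nat_le_iff)
    then show "(real c)\<^sup>2 \<le> real (2 * n)" by (simp add: power2_eq_square)
  qed
  have "card (sign_changes u n) \<le> card (sign_changes s m) + 1 + card (sign_changes t (n - m))"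
  \<comment> \<open>A change of \<open>u\<close> between steps i and i + 1 is, in the reversed
    order, a change of \<open>s\<close> between m - i - 2 and m - i - 1.\<close>
  proof (rule card_sign_changes_append_le[where f = "\<lambda>i. m - Suc (Suc i)"], goal_cases)
    case i: (1 i)
    then have "Suc (m - Suc (Suc i)) = m - Suc i" by auto
    then show ?case using i by (auto simp: sign_changes_def u_def)
  next
    case 2
    show ?case by (auto simp: inj_on_def)
  qed (auto simp: sign_changes_def u_def)
  then have "real (card (sign_changes u n)) \<le> 2 * sqrt (2 * n) + 1"
    using sq[OF p'(4) m(1)] sq[OF q'(4)] by simp
  then show ?thesis using U pos by (intro exI[of _ "\<lambda>i. w i - w 0"] exI[of _ u]) auto
qed

section \<open>Weights of positive walks\<close>

definition positive_walks :: "nat \<Rightarrow> nat \<Rightarrow> int list list set" where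
  "positive_walks d n = {w. positive_walk d n w}"

text \<open>The first coordinate may attain its extreme values repeatedly; an additional step keeps
  two walks apart when they are joined. The height \<open>h\<close> of the endpoint is fixed because
  only equal heights can be matched.\<close>

definition unfolded_walks :: "nat \<Rightarrow> nat \<Rightarrow> nat \<Rightarrow> int list list set" where
  "unfolded_walks d n h = {w. positive_walk d n w \<and>
     (\<forall>i\<le>n. 0 \<le> w ! i ! 0 \<and> w ! i ! 0 \<le> w ! n ! 0) \<and> w ! n ! (d - 1) = int h}"

definition walk_weight :: "nat \<Rightarrow> real \<Rightarrow> int list list set \<Rightarrow> real" where
  "walk_weight d a S = (\<Sum>w\<in>S. a ^ visits d w)"

text \<open>Adjacency depends only on the absolute coordinate differences, so it survives
  translations and reflections in a coordinate, also with the two vertices exchanged.\<close>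

lemma lattice_adj_transfer:
  assumes "lattice_adj d p q" "length p' = d" "length q' = d"
    and "\<And>j. j < d \<Longrightarrow> \<bar>p' ! j - q' ! j\<bar> = \<bar>p ! j - q ! j\<bar>"
  shows "lattice_adj d p' q'"
proof -
  obtain i where "i < d" "\<bar>p ! i - q ! i\<bar> = 1" "\<forall>j<d. j \<noteq> i \<longrightarrow> p ! j = q ! j"
    using assms(1) by (auto simp: lattice_adj_def)
  moreover have "p' ! j = q' ! j" if "j < d" "j \<noteq> i" for j
    using assms(4)[OF that(1)] that calculation by simp
  ultimately show ?thesis using assms(2-4) unfolding lattice_adj_def by metis
qed

lemma lattice_adj_coordinate_diff_le:
  assumes "lattice_adj d p q" "j < d"
  shows "\<bar>q ! j - p ! j\<bar> \<le> 1"
proof -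
  obtain i where "\<bar>p ! i - q ! i\<bar> = 1" "\<forall>j<d. j \<noteq> i \<longrightarrow> p ! j = q ! j"
    using assms(1) by (auto simp: lattice_adj_def)
  then show ?thesis using assms(2) by (cases "j = i") (auto simp: abs_minus_commute)
qed

section \<open>Finiteness and crude bounds for positive walks\<close>

lemma last_eq_nth: "length w = Suc n \<Longrightarrow> last w = w ! n"
  by (cases w rule: rev_cases) auto

lemma positive_walk_length: "positive_walk d n w \<Longrightarrow> i \<le> n \<Longrightarrow> length (w ! i) = d"
  by (simp add: positive_walk_def in_half_lattice_def)

lemma positive_walks_Suc_subset:
  "positive_walks d (Suc n) \<subseteq> (\<lambda>(w, i, s). w @ [(last w)[i := last w ! i + s]]) `
     (positive_walks d n \<times> {..<d} \<times> {1, -1})"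
proof
  fix w assume "w \<in> positive_walks d (Suc n)"
  then have w: "positive_walk d (Suc n) w" by (simp add: positive_walks_def)
  then have len: "length w = Suc (Suc n)" by (simp add: positive_walk_def)
  define v where "v = take (Suc n) w"
  have vi: "v ! i = w ! i" if "i \<le> n" for i using that by (simp add: v_def)
  have "positive_walk d n v" using w len vi by (auto simp: positive_walk_def v_def)
  moreover have lastv: "last v = w ! n" using len vi[of n] last_eq_nth[of v n] by (simp add: v_def)
  moreover have w_eq: "w = v @ [w ! Suc n]"
    using take_Suc_conv_app_nth[of "Suc n" w] len by (simp add: v_def)
  have adj: "lattice_adj d (w ! n) (w ! Suc n)" using w by (simp add: positive_walk_def)
  then obtain i where i: "i < d" "\<bar>w ! n ! i - w ! Suc n ! i\<bar> = 1"
      "\<forall>j<d. j \<noteq> i \<longrightarrow> w ! n ! j = w ! Suc n ! j"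
    by (auto simp: lattice_adj_def)
  define s where "s = w ! Suc n ! i - w ! n ! i"
  have "s = 1 \<or> s = -1" using i(2) by (auto simp: s_def)
  moreover have "w ! Suc n = (w ! n)[i := w ! n ! i + s]"
    using adj i by (intro nth_equalityI) (auto simp: lattice_adj_def s_def nth_list_update)
  ultimately show "w \<in> (\<lambda>(w, i, s). w @ [(last w)[i := last w ! i + s]]) `
     (positive_walks d n \<times> {..<d} \<times> {1, -1})"
    using w_eq i(1) by (intro image_eqI[of _ _ "(v, i, s)"]) (auto simp: positive_walks_def)
qed

lemma positive_walks_0: "positive_walks d 0 \<subseteq> {[replicate d 0]}"
  by (auto simp: positive_walks_def positive_walk_def length_Suc_conv)

lemma positive_walks_finite_card:
  "finite (positive_walks d n) \<and> card (positive_walks d n) \<le> (2 * d) ^ n"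
proof (induction n)
  case 0
  then show ?case using positive_walks_0[of d] finite_subset card_mono[OF _ positive_walks_0[of d]]
    by auto
next
  case (Suc n)
  let ?P = "positive_walks d n \<times> {..<d} \<times> {1, -1::int}"
  have fin: "finite ?P" using Suc by auto
  have "card (positive_walks d (Suc n)) \<le> card ?P"
    by (rule order_trans[OF card_mono[OF _ positive_walks_Suc_subset] card_image_le]) (use fin in auto)
  also have "\<dots> = card (positive_walks d n) * (2 * d)" by (simp add: card_cartesian_product)
  also have "\<dots> \<le> (2 * d) ^ Suc n" using Suc by (simp add: mult.commute)
  finally show ?case using finite_subset[OF positive_walks_Suc_subset[of d n]] fin by blast
qed

lemma finite_positive_walks [simp]: "finite (positive_walks d n)"
  using positive_walks_finite_card by blast

lemma unfolded_walks_subset: "unfolded_walks d n h \<subseteq> positive_walks d n"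
  by (auto simp: unfolded_walks_def positive_walks_def)

lemma finite_unfolded_walks [simp]: "finite (unfolded_walks d n h)"
  using finite_subset[OF unfolded_walks_subset] by simp

lemma visits_le: "length w = Suc n \<Longrightarrow> visits d w \<le> n"
  unfolding visits_def by (rule order_trans[OF card_mono[of "{1..n}"]]) auto

lemma A_plus_eq_walk_weight: "A_plus d n a = walk_weight d a (positive_walks d n)"
proof -
  have "walk_weight d a (positive_walks d n)
      = (\<Sum>v\<in>{0..n}. \<Sum>w\<in>{w \<in> positive_walks d n. visits d w = v}. a ^ visits d w)"
    unfolding walk_weight_def
  proof (rule sum.group[symmetric])
    show "visits d ` positive_walks d n \<subseteq> {0..n}"
      by (auto simp: positive_walks_def positive_walk_def intro: visits_le)
  qed auto
  also have "\<dots> = A_plus d n a"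
    by (simp add: A_plus_def c_plus_def positive_walks_def)
  finally show ?thesis ..
qed

lemma walk_weight_nonneg: "0 \<le> a \<Longrightarrow> 0 \<le> walk_weight d a S"
  by (simp add: walk_weight_def sum_nonneg)

lemma walk_weight_mono: "0 \<le> a \<Longrightarrow> finite T \<Longrightarrow> S \<subseteq> T \<Longrightarrow> walk_weight d a S \<le> walk_weight d a T"
  unfolding walk_weight_def by (rule sum_mono2) auto

text \<open>Crude, but it supplies the linear upper bound that Fekete's lemma needs. The maximum
  with 1 allows for \<open>a < 1\<close>, where fewer visits weigh more.\<close>

lemma A_plus_le:
  assumes "0 \<le> a"
  shows "A_plus d n a \<le> (2 * real d * max 1 a) ^ n"
proof -
  have "a ^ visits d w \<le> max 1 a ^ n" if "w \<in> positive_walks d n" for w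
  proof -
    have "a ^ visits d w \<le> max 1 a ^ visits d w" using assms by (intro power_mono) auto
    also have "\<dots> \<le> max 1 a ^ n"
      using that by (intro power_increasing visits_le) (auto simp: positive_walks_def positive_walk_def)
    finally show ?thesis .
  qed
  then have "A_plus d n a \<le> (\<Sum>w\<in>positive_walks d n. max 1 a ^ n)"
    unfolding A_plus_eq_walk_weight walk_weight_def by (rule sum_mono)
  also have "\<dots> = real (card (positive_walks d n)) * max 1 a ^ n" by simp
  also have "\<dots> \<le> real ((2 * d) ^ n) * max 1 a ^ n"
    using positive_walks_finite_card[of d n]
    by (intro mult_right_mono) (auto simp del: of_nat_power of_nat_mult simp: of_nat_le_iff)
  finally show ?thesis by (simp add: power_mult_distrib)
qed

section \<open>Joining unfolded walks that end at the same height\<close>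

lemma visits_conv_filter:
  "visits d w = length (filter (on_boundary d) (tl w))"
proof -
  have "{i. 1 \<le> i \<and> i < length w \<and> on_boundary d (w ! i)}
      = Suc ` {i. i < length (tl w) \<and> on_boundary d (tl w ! i)}"
  proof -
    have "i \<in> Suc ` {i. i < length (tl w) \<and> on_boundary d (tl w ! i)}"
      if "1 \<le> i" "i < length w" "on_boundary d (w ! i)" for i
      using that by (intro image_eqI[of _ _ "i - 1"]) (auto simp: nth_tl)
    then show ?thesis by (auto simp: nth_tl)
  qed
  then show ?thesis
    by (simp add: visits_def length_filter_conv_card card_image)
qed

text \<open>The second walk is traversed backwards and reflected in the first coordinate, so that it
  starts one step to the right of the first walk, at the same height, and ends on the boundary.\<close>

definition flip_into :: "nat \<Rightarrow> int list \<Rightarrow> int list \<Rightarrow> int list \<Rightarrow> int list" where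
  "flip_into d x y p = map (\<lambda>i. if i = 0 then x ! 0 + 1 + y ! 0 - p ! 0 else x ! i + p ! i - y ! i) [0..<d]"

definition join_walks :: "nat \<Rightarrow> int list list \<Rightarrow> int list list \<Rightarrow> int list list" where
  "join_walks d u v = u @ map (flip_into d (last u) (last v)) (rev v)"

lemma length_flip_into [simp]: "length (flip_into d x y p) = d"
  by (simp add: flip_into_def)

lemma nth_flip_into: "i < d \<Longrightarrow> flip_into d x y p ! i =
    (if i = 0 then x ! 0 + 1 + y ! 0 - p ! 0 else x ! i + p ! i - y ! i)"
  by (simp add: flip_into_def)

lemma flip_into_inject:
  assumes "flip_into d x y p = flip_into d x y q" "length p = d" "length q = d"
  shows "p = q"
proof (rule nth_equalityI)
  fix i assume "i < length p"
  then have i: "i < d" using assms by simp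
  have "flip_into d x y p ! i = flip_into d x y q ! i" using assms by simp
  then show "p ! i = q ! i" unfolding nth_flip_into[OF i] by (auto split: if_splits)
qed (use assms in simp)

text \<open>The images of \<open>v\<close> have first coordinate at least one more than the endpoint
  of \<open>u\<close> and at most that of the image of the origin, now the last vertex. Equal final
  heights make the map preserve heights. The connecting step accounts for the additional length, and
  the origin of \<open>v\<close>, which is not a visit of \<open>v\<close>, for the additional
  visit.\<close>

lemma join_walks_unfolded:
  assumes d: "2 \<le> d" and u: "u \<in> unfolded_walks d n h" and v: "v \<in> unfolded_walks d m h"
  shows "join_walks d u v \<in> unfolded_walks d (n + m + 1) 0"
    and "visits d (join_walks d u v) = visits d u + visits d v + 1"
proof -
  have pu: "positive_walk d n u" and pv: "positive_walk d m v"
    using u v by (auto simp: unfolded_walks_def)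
  have lu: "length u = Suc n" and lv: "length v = Suc m"
    using pu pv by (auto simp: positive_walk_def)
  have u_last: "last u = u ! n" and v_last: "last v = v ! m"
    using lu lv by (auto simp: last_eq_nth)
  define f where "f = flip_into d (u ! n) (v ! m)"
  have J: "join_walks d u v = u @ map f (rev v)" by (simp add: join_walks_def f_def u_last v_last)
  have f_len: "length (f p) = d" for p by (simp add: f_def)
  have f_0: "f p ! 0 = u ! n ! 0 + 1 + v ! m ! 0 - p ! 0" for p
    using d by (simp add: f_def nth_flip_into)
  have f_height: "f p ! (d - 1) = p ! (d - 1)" for p
    using d u v by (simp add: f_def nth_flip_into unfolded_walks_def)
  have f_adj: "lattice_adj d (f q) (f p)" if "lattice_adj d p q" for p q
    by (rule lattice_adj_transfer[OF that]) (auto simp: f_def nth_flip_into)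
  have nth_low: "join_walks d u v ! i = u ! i" if "i \<le> n" for i
    using that lu by (simp add: J nth_append)
  have nth_high: "join_walks d u v ! i = f (v ! (n + m + 1 - i))" if "n < i" "i \<le> n + m + 1" for i
    using that lu lv by (simp add: J nth_append rev_nth Suc_diff_le add.commute)
  have cases: "P (join_walks d u v ! i)" if "i \<le> n + m + 1"
      "\<And>k. k \<le> n \<Longrightarrow> P (u ! k)" "\<And>k. k \<le> m \<Longrightarrow> P (f (v ! k))" for P i
    using that nth_low[of i] nth_high[of i] by (cases "i \<le> n") auto
  have u0: "0 \<le> u ! i ! 0" "u ! i ! 0 \<le> u ! n ! 0" if "i \<le> n" for i
    using u that by (auto simp: unfolded_walks_def)
  have v0: "0 \<le> v ! i ! 0" "v ! i ! 0 \<le> v ! m ! 0" if "i \<le> m" for i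
    using v that by (auto simp: unfolded_walks_def)
  have v_origin: "v ! 0 = replicate d 0" using pv by (simp add: positive_walk_def)
  have last_eq: "join_walks d u v ! (n + m + 1) = f (replicate d 0)"
    using nth_high[of "n + m + 1"] v_origin by simp
  have len: "length (join_walks d u v) = n + m + 1 + 1" using lu lv by (simp add: J)
  have "distinct (join_walks d u v)"
  proof -
    have "inj_on f (set v)"
    proof (rule inj_onI)
      fix p q assume pq: "p \<in> set v" "q \<in> set v" "f p = f q"
      have "length r = d" if "r \<in> set v" for r
        using that positive_walk_length[OF pv] lv by (auto simp: in_set_conv_nth)
      then show "p = q" using flip_into_inject pq unfolding f_def by blast
    qed
    moreover have "set u \<inter> f ` set v = {}"
    proof -
      have "u ! i \<noteq> f (v ! j)" if "i \<le> n" "j \<le> m" for i j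
      proof -
        have "u ! i ! 0 < f (v ! j) ! 0" using u0[OF that(1)] v0[OF that(2)] f_0 by simp
        then show ?thesis by auto
      qed
      then show ?thesis using lu lv by (force simp: in_set_conv_nth)
    qed
    ultimately show ?thesis
      using pu pv by (auto simp: J positive_walk_def distinct_map)
  qed
  moreover have "in_half_lattice d (join_walks d u v ! i)" if "i \<le> n + m + 1" for i
    by (rule cases[OF that])
      (use pu pv f_len f_height in \<open>auto simp: positive_walk_def in_half_lattice_def\<close>)
  moreover have "lattice_adj d (join_walks d u v ! i) (join_walks d u v ! Suc i)" if "i < n + m + 1" for i
  proof -
    consider "i < n" | "i = n" | "n < i" by linarith
    then show ?thesis
    proof cases
      case 1
      then show ?thesis using nth_low[of i] nth_low[of "Suc i"] pu by (simp add: positive_walk_def)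
    next
      case 2
      have "lattice_adj d (u ! n) (f (v ! m))"
        unfolding lattice_adj_def using d positive_walk_length[OF pu, of n] f_len
        by (auto simp: f_def nth_flip_into intro!: exI[of _ 0])
      then show ?thesis using nth_low[of n] nth_high[of "Suc n"] 2 by simp
    next
      case 3
      define k where "k = n + m + 1 - Suc i"
      have "Suc k = n + m + 1 - i" "k < m" using 3 that by (auto simp: k_def)
      moreover have "lattice_adj d (v ! k) (v ! Suc k)"
        using pv \<open>k < m\<close> by (simp add: positive_walk_def)
      ultimately show ?thesis
        using nth_high[of i] nth_high[of "Suc i"] 3 that f_adj[of "v ! k" "v ! Suc k"] k_def by simp
    qed
  qed
  moreover have "join_walks d u v ! 0 = replicate d 0"
    using nth_low[of 0] pu by (simp add: positive_walk_def)
  ultimately have "positive_walk d (n + m + 1) (join_walks d u v)"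
    using len by (simp add: positive_walk_def)
  moreover have "0 \<le> join_walks d u v ! i ! 0 \<and>
      join_walks d u v ! i ! 0 \<le> join_walks d u v ! (n + m + 1) ! 0" if i: "i \<le> n + m + 1" for i
  proof (rule cases[OF i])
    have l: "join_walks d u v ! (n + m + 1) ! 0 = u ! n ! 0 + 1 + v ! m ! 0"
      using last_eq f_0 d by simp
    show "0 \<le> u ! k ! 0 \<and> u ! k ! 0 \<le> join_walks d u v ! (n + m + 1) ! 0" if "k \<le> n" for k
      using u0[OF that] v0[of m] l by simp
    show "0 \<le> f (v ! k) ! 0 \<and> f (v ! k) ! 0 \<le> join_walks d u v ! (n + m + 1) ! 0" if "k \<le> m" for k
      using v0[OF that] u0[of n] l f_0 by simp
  qed
  moreover have "join_walks d u v ! (n + m + 1) ! (d - 1) = int 0"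
    using last_eq f_height d by simp
  ultimately show "join_walks d u v \<in> unfolded_walks d (n + m + 1) 0"
    by (simp add: unfolded_walks_def)
  have bf: "on_boundary d (f p) \<longleftrightarrow> on_boundary d p" if "p \<in> set v" for p
  proof -
    have "length p = d" using that positive_walk_length[OF pv] lv by (auto simp: in_set_conv_nth)
    then show ?thesis using f_len f_height by (simp add: on_boundary_def)
  qed
  have "length (filter (on_boundary d) (map f (rev v))) = length (filter (on_boundary d) v)"
    using bf by (simp add: filter_map o_def rev_filter[symmetric] cong: filter_cong)
  moreover obtain v' where "v = replicate d 0 # v'" using v_origin lv by (cases v) auto
  then have "length (filter (on_boundary d) v) = Suc (visits d v)"
    using d by (simp add: visits_conv_filter on_boundary_def)
  moreover have "tl (join_walks d u v) = tl u @ map f (rev v)" unfolding J using lu by (cases u) auto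
  ultimately show "visits d (join_walks d u v) = visits d u + visits d v + 1"
    by (simp add: visits_conv_filter)
qed

text \<open>The known length of \<open>u\<close> separates the two pieces. The last vertex of the
  joined walk is the image of the origin, which reveals the endpoint of \<open>v\<close> once that
  of \<open>u\<close> is known; then \<open>flip_into\<close> can be inverted vertex by
  vertex.\<close>

lemma join_walks_inject:
  assumes "join_walks d u v = join_walks d u' v'"
    and "positive_walk d n u" "positive_walk d n u'" "positive_walk d m v" "positive_walk d m v'"
  shows "u = u' \<and> v = v'"
proof -
  have len: "length u = length u'" "length v = Suc m" "length v' = Suc m"
    using assms by (auto simp: positive_walk_def)
  have eq: "u = u'" "map (flip_into d (last u) (last v)) (rev v) = map (flip_into d (last u) (last v')) (rev v')"
    using assms(1) len unfolding join_walks_def by auto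
  have nth: "flip_into d (last u) (last v) (v ! i) = flip_into d (last u) (last v') (v' ! i)" if "i \<le> m" for i
  proof -
    have "map (flip_into d (last u) (last v)) (rev v) ! (m - i)
        = map (flip_into d (last u) (last v')) (rev v') ! (m - i)" using eq(2) by simp
    then show ?thesis using that len by (simp add: rev_nth)
  qed
  have org: "v ! 0 = replicate d 0" "v' ! 0 = replicate d 0" using assms by (auto simp: positive_walk_def)
  have "last v = last v'"
  proof (rule nth_equalityI)
    have ll: "length (last v) = d" "length (last v') = d"
      using assms(4,5) len positive_walk_length[of d m _ m] by (auto simp: last_eq_nth)
    then show "length (last v) = length (last v')" by simp
    fix i assume "i < length (last v)"
    then have i: "i < d" using ll by simp
    have "flip_into d (last u) (last v) (v ! 0) ! i = flip_into d (last u) (last v') (v' ! 0) ! i"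
      using nth[of 0] by simp
    then show "last v ! i = last v' ! i"
      unfolding nth_flip_into[OF i] org using i by (auto split: if_splits)
  qed
  then have "v ! i = v' ! i" if "i \<le> m" for i
    using nth[OF that] positive_walk_length[OF assms(4) that] positive_walk_length[OF assms(5) that]
    by (auto intro: flip_into_inject)
  then have "v = v'" using len by (intro nth_equalityI) auto
  then show ?thesis using eq by simp
qed

text \<open>Joining is injective, and the factor \<open>a\<close> pays for the visit that it
  adds.\<close>

lemma walk_weight_unfolded_mult_le:
  assumes "2 \<le> d" "0 \<le> a"
  shows "a * walk_weight d a (unfolded_walks d n h) * walk_weight d a (unfolded_walks d m h)
    \<le> walk_weight d a (unfolded_walks d (n + m + 1) 0)"
proof -
  let ?P = "unfolded_walks d n h \<times> unfolded_walks d m h"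
  have "a * walk_weight d a (unfolded_walks d n h) * walk_weight d a (unfolded_walks d m h)
      = (\<Sum>(u, v)\<in>?P. a ^ (visits d u + visits d v + 1))"
    by (simp add: walk_weight_def sum_product sum.cartesian_product sum_distrib_left power_add mult_ac)
  also have "\<dots> = (\<Sum>p\<in>?P. a ^ visits d (case_prod (join_walks d) p))"
    by (rule sum.cong) (auto simp: join_walks_unfolded(2)[OF assms(1)])
  also have "\<dots> = walk_weight d a (case_prod (join_walks d) ` ?P)"
  proof -
    have "inj_on (case_prod (join_walks d)) ?P"
      by (rule inj_onI) (auto simp: unfolded_walks_def dest!: join_walks_inject)
    then show ?thesis by (simp add: walk_weight_def sum.reindex)
  qed
  also have "\<dots> \<le> walk_weight d a (unfolded_walks d (n + m + 1) 0)"
    using assms join_walks_unfolded(1) by (intro walk_weight_mono) auto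
  finally show ?thesis .
qed

section \<open>Encoding a walk by its unfolding and the reflection times\<close>

lemma unfold_positive_walk:
  assumes d: "2 \<le> d" and w: "positive_walk d n w"
  shows "\<exists>v s. v \<in> (\<Union>h\<le>n. unfolded_walks d n h) \<and> visits d v = visits d w \<and>
     (\<forall>i\<le>n. (w ! i)[0 := 0] = (v ! i)[0 := 0]) \<and>
     (\<forall>i<n. (s i = 1 \<or> s i = -1) \<and> w ! Suc i ! 0 - w ! i ! 0 = s i * (v ! Suc i ! 0 - v ! i ! 0)) \<and>
     real (card (sign_changes s n)) \<le> 2 * sqrt (2 * n) + 1"
proof -
  define x where "x i = w ! i ! 0" for i
  define y where "y i = (w ! i)[0 := 0]" for i
  have len: "length (w ! i) = d" if "i \<le> n" for i using positive_walk_length[OF w that] .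
  have lw: "length w = Suc n" and dist: "distinct w" using w by (auto simp: positive_walk_def)
  have adj: "lattice_adj d (w ! i) (w ! Suc i)" if "i < n" for i using w that by (simp add: positive_walk_def)
  have restore: "w ! i = (y i)[0 := x i]" if "i \<le> n" for i
    using len[OF that] d by (simp add: x_def y_def)
  have "inj_on (\<lambda>i. (x i, y i)) {..n}"
  proof (rule inj_onI)
    fix i j assume ij: "i \<in> {..n}" "j \<in> {..n}" "(x i, y i) = (x j, y j)"
    then have "w ! i = w ! j" using restore[of i] restore[of j] by simp
    then show "i = j" using ij lw dist by (simp add: nth_eq_iff_index_eq)
  qed
  moreover have "\<forall>i<n. \<bar>x (Suc i) - x i\<bar> \<le> 1"
    using lattice_adj_coordinate_diff_le[OF adj] d by (simp add: x_def)
  ultimately obtain x' s where U: "unfolding_of x y n x' s" "x' 0 = 0" "\<forall>i\<le>n. 0 \<le> x' i"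
    and c: "real (card (sign_changes s n)) \<le> 2 * sqrt (2 * n) + 1"
    using unfold_walk by blast
  have s: "s i = 1 \<or> s i = -1" "x' (Suc i) - x' i = s i * (x (Suc i) - x i)" if "i < n" for i
    using U(1) that by (auto simp: unfolding_of_def)
  have inj: "inj_on (\<lambda>i. (x' i, y i)) {..n}" and max: "\<forall>i\<le>n. x' i \<le> x' n"
    using U(1) by (auto simp: unfolding_of_def)
  define v where "v = map (\<lambda>i. (w ! i)[0 := x' i]) [0..<Suc n]"
  have lv: "length v = Suc n" by (simp add: v_def)
  have vi: "v ! i = (w ! i)[0 := x' i]" if "i \<le> n" for i
    using that by (simp add: v_def del: upt_Suc)
  have v0: "v ! i ! 0 = x' i" if "i \<le> n" for i using vi[OF that] len[OF that] d by simp
  have vj: "v ! i ! j = w ! i ! j" if "i \<le> n" "0 < j" for i j using vi[OF that(1)] that(2) by simp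
  have v_len: "length (v ! i) = d" if "i \<le> n" for i using vi len that by simp
  have step: "\<bar>x' (Suc i) - x' i\<bar> = \<bar>x (Suc i) - x i\<bar>" if "i < n" for i
    using s[OF that] by auto
  have v_adj: "lattice_adj d (v ! i) (v ! Suc i)" if i: "i < n" for i
  proof (rule lattice_adj_transfer[OF adj[OF i]])
    fix j assume "j < d"
    show "\<bar>v ! i ! j - v ! Suc i ! j\<bar> = \<bar>w ! i ! j - w ! Suc i ! j\<bar>"
      using step[OF i] i v0[of i] v0[of "Suc i"] vj[of i j] vj[of "Suc i" j]
      by (cases "j = 0") (auto simp: x_def abs_minus_commute)
  qed (use v_len i in auto)
  have "distinct v"
    unfolding distinct_conv_nth
  proof (intro allI impI)
    fix i j assume ij: "i < length v" "j < length v" "i \<noteq> j"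
    show "v ! i \<noteq> v ! j"
    proof
      assume eq: "v ! i = v ! j"
      then have "x' i = x' j" using v0[of i] v0[of j] ij lv by simp
      moreover have "y i = y j"
        using arg_cong[OF eq, of "\<lambda>p. p[0 := 0]"] vi[of i] vi[of j] ij lv by (simp add: y_def)
      ultimately show False using inj_onD[OF inj, of i j] ij lv by auto
    qed
  qed
  moreover have "v ! 0 = replicate d 0"
    using vi[of 0] U(2) w d by (simp add: positive_walk_def) (cases d; simp)
  moreover have half: "in_half_lattice d (v ! i)" if "i \<le> n" for i
    using w that vj[OF that, of "d - 1"] v_len[OF that] d by (simp add: positive_walk_def in_half_lattice_def)
  ultimately have pv: "positive_walk d n v" using lv v_adj by (simp add: positive_walk_def)
  \<comment> \<open>A walk of n steps reaches height at most n, so only the classes with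
    \<open>h \<le> n\<close> occur.\<close>
  have "v ! i ! (d - 1) \<le> int i" if "i \<le> n" for i
    using that
  proof (induction i)
    case 0
    then show ?case using \<open>v ! 0 = replicate d 0\<close> d by simp
  next
    case (Suc i)
    then show ?case
      using lattice_adj_coordinate_diff_le[OF v_adj[of i], of "d - 1"] d by simp
  qed
  then have "v ! n ! (d - 1) \<le> int n" by simp
  moreover have "0 \<le> v ! n ! (d - 1)" using half[of n] by (simp add: in_half_lattice_def)
  ultimately obtain h where "h \<le> n" "v ! n ! (d - 1) = int h"
    by (metis of_nat_le_iff zero_le_imp_eq_int)
  then have "v \<in> (\<Union>h\<le>n. unfolded_walks d n h)"
    using pv v0 U(3) max by (auto simp: unfolded_walks_def)
  moreover have "visits d v = visits d w"
  proof -
    have "on_boundary d (v ! i) \<longleftrightarrow> on_boundary d (w ! i)" if "i \<le> n" for i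
      using vj[OF that, of "d - 1"] v_len[OF that] len[OF that] d by (simp add: on_boundary_def)
    then have "{i. 1 \<le> i \<and> i < length v \<and> on_boundary d (v ! i)}
        = {i. 1 \<le> i \<and> i < length w \<and> on_boundary d (w ! i)}"
      using lv lw by auto
    then show ?thesis by (simp add: visits_def)
  qed
  moreover have "\<forall>i\<le>n. (w ! i)[0 := 0] = (v ! i)[0 := 0]" using vi by simp
  \<comment> \<open>Each sign is its own inverse, so the steps of \<open>w\<close> are recovered
    from those of \<open>v\<close> with the same \<open>s\<close>.\<close>
  moreover have "\<forall>i<n. (s i = 1 \<or> s i = -1) \<and> w ! Suc i ! 0 - w ! i ! 0 = s i * (v ! Suc i ! 0 - v ! i ! 0)"
  proof (intro allI impI)
    fix i assume "i < n"
    then show "(s i = 1 \<or> s i = -1) \<and> w ! Suc i ! 0 - w ! i ! 0 = s i * (v ! Suc i ! 0 - v ! i ! 0)"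
      using s[of i] v0[of i] v0[of "Suc i"] by (auto simp: x_def)
  qed
  ultimately show ?thesis using c by blast
qed

text \<open>A set of at most k elements is listed and padded to length k with the dummy entry
  \<open>n\<close>, which lies outside \<open>{..<n}\<close>; there are (n + 1) ^ k such lists at
  most.\<close>

lemma card_small_subsets_le:
  "finite {D. D \<subseteq> {..<n} \<and> card D \<le> k} \<and> card {D. D \<subseteq> {..<n} \<and> card D \<le> k} \<le> (n + 1) ^ k"
proof -
  let ?L = "{xs. set xs \<subseteq> {..n} \<and> length xs = k}"
  have sub: "{D. D \<subseteq> {..<n} \<and> card D \<le> k} \<subseteq> (\<lambda>xs. set xs - {n}) ` ?L"
  proof
    fix D assume "D \<in> {D. D \<subseteq> {..<n} \<and> card D \<le> k}"
    then have D: "D \<subseteq> {..<n}" "card D \<le> k" by auto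
    then have "finite D" using finite_subset by blast
    define xs where "xs = sorted_list_of_set D @ replicate (k - card D) n"
    have "set xs - {n} = D" using D \<open>finite D\<close> by (auto simp: xs_def)
    moreover have "xs \<in> ?L" using D \<open>finite D\<close> by (auto simp: xs_def)
    ultimately show "D \<in> (\<lambda>xs. set xs - {n}) ` ?L" by blast
  qed
  have fin: "finite ?L" by (rule finite_lists_length_eq) simp
  have "card {D. D \<subseteq> {..<n} \<and> card D \<le> k} \<le> card ?L"
    using order_trans[OF card_mono[OF _ sub] card_image_le] fin by blast
  also have "card ?L = (n + 1) ^ k" by (simp add: card_lists_length_eq)
  finally show ?thesis using finite_subset[OF sub] fin by blast
qed

lemma sign_sequence_eqI:
  assumes "\<And>i. i < n \<Longrightarrow> s i = 1 \<or> s i = -1" "\<And>i. i < n \<Longrightarrow> t i = 1 \<or> t i = (-1::int)"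
    and "s 0 = 1 \<longleftrightarrow> t 0 = 1" "sign_changes s n = sign_changes t n" "i < n"
  shows "s i = t i"
  using \<open>i < n\<close>
proof (induction i)
  case 0
  then show ?case using assms(1)[of 0] assms(2)[of 0] assms(3) by auto
next
  case (Suc i)
  have "i \<in> sign_changes s n \<longleftrightarrow> i \<in> sign_changes t n" using assms(4) by simp
  then have "s i = s (Suc i) \<longleftrightarrow> t i = t (Suc i)" using Suc.prems by (auto simp: sign_changes_def)
  moreover have "s i = t i" using Suc by simp
  ultimately show ?case
    using assms(1)[of i] assms(1)[of "Suc i"] assms(2)[of "Suc i"] Suc.prems by fastforce
qed

text \<open>A sign sequence is determined by whether it begins with 1 and by the set of its sign
  changes, so these codes suffice to undo an unfolding. Their number is exp (O (sqrt n * log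
  n)).\<close>

definition unfolding_codes :: "nat \<Rightarrow> (bool \<times> nat set) set" where
  "unfolding_codes n = UNIV \<times> {D. D \<subseteq> {..<n} \<and> card D \<le> nat \<lfloor>2 * sqrt (2 * n) + 1\<rfloor>}"

text \<open>A walk is determined by its unfolding, its code and its fixed starting point, and
  unfolding keeps the number of visits. Hence the weight is at most that of all pairs of an unfolded
  walk and a code.\<close>

lemma A_plus_le_unfolded:
  assumes d: "2 \<le> d" and a: "0 \<le> a"
  shows "A_plus d n a \<le> real (card (unfolding_codes n)) *
     (\<Sum>h\<le>n. walk_weight d a (unfolded_walks d n h))"
proof -
  let ?U = "\<Union>h\<le>n. unfolded_walks d n h"
  define good where "good w v s \<longleftrightarrow> v \<in> ?U \<and> visits d v = visits d w \<and>
     (\<forall>i\<le>n. (w ! i)[0 := 0] = (v ! i)[0 := 0]) \<and>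
     (\<forall>i<n. (s i = 1 \<or> s i = -1) \<and> w ! Suc i ! 0 - w ! i ! 0 = s i * (v ! Suc i ! 0 - v ! i ! 0)) \<and>
     real (card (sign_changes s n)) \<le> 2 * sqrt (2 * n) + 1" for w v s
  have "\<forall>w\<in>positive_walks d n. \<exists>v s. good w v s"
    using unfold_positive_walk[OF d] by (auto simp only: positive_walks_def mem_Collect_eq good_def)
  then obtain V S where "\<forall>w\<in>positive_walks d n. good w (V w) (S w)" by metis
  then have VS: "\<And>w. w \<in> positive_walks d n \<Longrightarrow> V w \<in> ?U \<and> visits d (V w) = visits d w \<and>
     (\<forall>i\<le>n. (w ! i)[0 := 0] = (V w ! i)[0 := 0]) \<and>
     (\<forall>i<n. (S w i = 1 \<or> S w i = -1) \<and> w ! Suc i ! 0 - w ! i ! 0 = S w i * (V w ! Suc i ! 0 - V w ! i ! 0)) \<and>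
     real (card (sign_changes (S w) n)) \<le> 2 * sqrt (2 * n) + 1"
    unfolding good_def by blast
  define C where "C w = (V w, S w 0 = 1, sign_changes (S w) n)" for w
  have inj: "inj_on C (positive_walks d n)"
  proof (rule inj_onI)
    fix w w' assume w: "w \<in> positive_walks d n" "w' \<in> positive_walks d n" "C w = C w'"
    then have V: "V w = V w'" and S0: "S w 0 = 1 \<longleftrightarrow> S w' 0 = 1"
      and ch: "sign_changes (S w) n = sign_changes (S w') n"
      by (auto simp: C_def)
    note p = VS[OF w(1)] VS[OF w(2)]
    have S: "S w i = S w' i" if "i < n" for i
      by (rule sign_sequence_eqI[OF _ _ S0 ch that]) (use p in blast)+
    have pw: "positive_walk d n w" "positive_walk d n w'" using w by (auto simp: positive_walks_def)
    have x: "w ! i ! 0 = w' ! i ! 0" if "i \<le> n" for i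
      using that
    proof (induction i)
      case 0
      then show ?case using pw by (simp add: positive_walk_def)
    next
      case (Suc i)
      then have "w ! Suc i ! 0 - w ! i ! 0 = w' ! Suc i ! 0 - w' ! i ! 0"
        using p S[of i] V by (metis Suc_le_lessD)
      then show ?case using Suc by simp
    qed
    have "w ! i = w' ! i" if "i \<le> n" for i
    proof -
      have "(w ! i)[0 := 0] = (w' ! i)[0 := 0]" using p V that by metis
      then have "(w ! i)[0 := 0, 0 := w ! i ! 0] = (w' ! i)[0 := 0, 0 := w ! i ! 0]" by simp
      then show ?thesis using x[OF that] by (metis list_update_id list_update_overwrite)
    qed
    then show "w = w'" using pw by (intro nth_equalityI) (auto simp: positive_walk_def)
  qed
  have finU: "finite ?U" by simp
  have finC: "finite (unfolding_codes n)"
    using card_small_subsets_le by (auto simp: unfolding_codes_def)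
  have sub: "C ` positive_walks d n \<subseteq> ?U \<times> unfolding_codes n"
  proof
    fix c assume "c \<in> C ` positive_walks d n"
    then obtain w where w: "w \<in> positive_walks d n" "c = C w" by blast
    have "card (sign_changes (S w) n) \<le> nat \<lfloor>2 * sqrt (2 * n) + 1\<rfloor>"
      by (rule le_nat_floor) (use VS[OF w(1)] in blast)
    then show "c \<in> ?U \<times> unfolding_codes n"
      using VS[OF w(1)] w(2) by (auto simp: C_def unfolding_codes_def sign_changes_def)
  qed
  have "A_plus d n a = (\<Sum>w\<in>positive_walks d n. a ^ visits d (fst (C w)))"
    unfolding A_plus_eq_walk_weight walk_weight_def
    by (rule sum.cong) (use VS in \<open>auto simp: C_def\<close>)
  also have "\<dots> = (\<Sum>c\<in>C ` positive_walks d n. a ^ visits d (fst c))"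
    using inj by (simp add: sum.reindex)
  also have "\<dots> \<le> (\<Sum>c\<in>?U \<times> unfolding_codes n. a ^ visits d (fst c))"
    using sub finU finC a by (intro sum_mono2) auto
  also have "\<dots> = real (card (unfolding_codes n)) * walk_weight d a ?U"
    by (simp add: walk_weight_def sum.cartesian_product' sum_distrib_left mult.commute)
  also have "walk_weight d a ?U = (\<Sum>h\<le>n. walk_weight d a (unfolded_walks d n h))"
    unfolding walk_weight_def
  proof (rule sum.UNION_disjoint)
    show "\<forall>i\<in>{..n}. \<forall>j\<in>{..n}. i \<noteq> j \<longrightarrow> unfolded_walks d n i \<inter> unfolded_walks d n j = {}"
      by (auto simp: unfolded_walks_def)
  qed auto
  finally show ?thesis .
qed

lemma card_unfolding_codes_le:
  "real (card (unfolding_codes n)) \<le> 2 * (real n + 1) powr (2 * sqrt (2 * n) + 1)"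
proof -
  let ?k = "nat \<lfloor>2 * sqrt (2 * n) + 1\<rfloor>"
  have "card (unfolding_codes n) = 2 * card {D. D \<subseteq> {..<n} \<and> card D \<le> ?k}"
    by (simp add: unfolding_codes_def card_cartesian_product)
  also have "\<dots> \<le> 2 * (n + 1) ^ ?k" using card_small_subsets_le by simp
  finally have "real (card (unfolding_codes n)) \<le> real (2 * (n + 1) ^ ?k)"
    by (simp only: of_nat_le_iff)
  also have "\<dots> = 2 * (real n + 1) ^ ?k" by (simp add: add.commute)
  also have "(real n + 1) ^ ?k = (real n + 1) powr real ?k" by (rule powr_realpow[symmetric]) simp
  also have "2 * (real n + 1) powr real ?k \<le> 2 * (real n + 1) powr (2 * sqrt (2 * n) + 1)"
    by (intro mult_left_mono powr_mono) auto
  finally show ?thesis .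
qed

section \<open>The growth rate of positive walks\<close>

text \<open>Fekete's lemma: the limit is the supremum of the quotients. To approach it from below, n
  is divided by an m whose quotient is nearly optimal. Superadditivity concerns positive indices
  only, so a vanishing remainder is a separate case.\<close>

lemma fekete_superadditive:
  fixes x :: "nat \<Rightarrow> real"
  assumes super: "\<And>j k. 0 < j \<Longrightarrow> 0 < k \<Longrightarrow> x j + x k \<le> x (j + k)"
    and bound: "\<And>k. 0 < k \<Longrightarrow> x k \<le> C * real k"
  shows "\<exists>l. (\<lambda>k. x k / real k) \<longlonglongrightarrow> l"
proof -
  define l where "l = (SUP k\<in>{0<..}. x k / real k)"
  have bdd: "bdd_above ((\<lambda>k. x k / real k) ` {0<..})"
    using bound by (intro bdd_aboveI2[of _ _ C]) (simp add: field_simps)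
  have upper: "x k / real k \<le> l" if "0 < k" for k
    unfolding l_def by (rule cSUP_upper[OF _ bdd]) (use that in simp)
  have mult: "real q * x m \<le> x (q * m)" if "0 < m" "0 < q" for q m
    using \<open>0 < q\<close>
  proof (induction q)
    case (Suc q)
    then show ?case using super[of m "q * m"] that by (cases "q = 0") (auto simp: algebra_simps)
  qed simp
  have "(\<lambda>k. x k / real k) \<longlonglongrightarrow> l"
  proof (rule order_tendstoI)
    fix b assume "l < b"
    then show "\<forall>\<^sub>F k in sequentially. x k / real k < b"
      using upper by (intro eventually_sequentiallyI[of 1]) (meson le_less_trans less_le_trans zero_less_one)
  next
    fix b assume b: "b < l"
    then obtain c where c: "b < c" "c < l" using dense by blast
    then obtain m where m: "0 < m" "c < x m / real m"
      unfolding l_def by (subst (asm) less_cSUP_iff) (use bdd in auto)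
    \<comment> \<open>Bounds the loss from the remainder \<open>r < m\<close>, uniformly in
      n.\<close>
    define E where "E = (\<Sum>r<m. \<bar>x r\<bar>)"
    have E: "\<bar>x r\<bar> \<le> E" if "r < m" for r
      unfolding E_def using that by (intro member_le_sum) auto
    have "0 \<le> E" by (simp add: E_def sum_nonneg)
    have low: "c - (m * \<bar>c\<bar> + E) / n \<le> x n / n" if "m \<le> n" for n
    proof -
      define q r where "q = n div m" and "r = n mod m"
      have n: "n = q * m + r" and r: "r < m" and q: "0 < q"
        using m(1) that by (auto simp: q_def r_def div_greater_zero_iff)
      have "real q * x m - E \<le> x n"
      proof (cases "r = 0")
        case True
        then show ?thesis using mult[OF m(1) q] n \<open>0 \<le> E\<close> by simp
      next
        case False
        then have "x (q * m) + x r \<le> x n" using super[of "q * m" r] m(1) q n by simp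
        then show ?thesis using mult[OF m(1) q] E[OF r] by linarith
      qed
      moreover have "real q * (c * m) \<le> real q * x m"
        using m by (intro mult_left_mono) (auto simp: field_simps)
      moreover have "real q * (c * m) = c * n - c * r" using n by (simp add: algebra_simps)
      moreover have "c * r \<le> \<bar>c\<bar> * m"
        using r by (intro mult_mono) auto
      ultimately have "c * n - (m * \<bar>c\<bar> + E) \<le> x n" by (simp add: mult.commute)
      then have "(c * n - (m * \<bar>c\<bar> + E)) / n \<le> x n / n" by (rule divide_right_mono) simp
      then show ?thesis using m(1) that by (simp add: diff_divide_distrib)
    qed
    have "(\<lambda>n. c - (m * \<bar>c\<bar> + E) / real n) \<longlonglongrightarrow> c - 0"
      by (intro tendsto_intros lim_const_over_n)
    then have "\<forall>\<^sub>F n in sequentially. b < c - (m * \<bar>c\<bar> + E) / real n"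
      using c(1) by (auto dest: order_tendstoD)
    then show "\<forall>\<^sub>F n in sequentially. b < x n / real n"
      using eventually_ge_at_top[of m]
      by eventually_elim (use low in \<open>auto intro: less_le_trans\<close>)
  qed
  then show ?thesis ..
qed

lemma origin_walk_unfolded: "0 < d \<Longrightarrow> unfolded_walks d 0 0 = {[replicate d 0]}"
  using unfolded_walks_subset[of d 0 0] positive_walks_0[of d]
  by (auto simp: unfolded_walks_def positive_walk_def in_half_lattice_def)

text \<open>The sandwich is \<open>B (n + 1) / a \<le> A_plus d n a \<le> exp (F n) * sqrt (B (2 * n
  + 2))\<close> with \<open>F n\<close> sublinear. Fekete's lemma makes ln (B k) / k converge, and
  both bounds then have the same exponential rate.\<close>

lemma A_plus_growth_rate:
  assumes d: "2 \<le> d" and a: "0 < a"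
  shows "(\<forall>n. 0 < A_plus d n a) \<and> (\<exists>l. (\<lambda>n. ln (A_plus d n a) / real n) \<longlonglongrightarrow> l)"
proof -
  \<comment> \<open>Joining adds one step and one visit. The shift of the length and the factor
    \<open>a\<close> absorb both, so that \<open>B\<close> is exactly supermultiplicative.\<close>
  define B where "B k = a * walk_weight d a (unfolded_walks d (k - 1) 0)" for k
  have a0: "0 \<le> a" using a by simp
  have super: "B j * B k \<le> B (j + k)" if "0 < j" "0 < k" for j k
  proof -
    have eq: "j - 1 + (k - 1) + 1 = j + k - 1" using that by simp
    show ?thesis
      using mult_left_mono[OF walk_weight_unfolded_mult_le[OF d a0, of "j - 1" 0 "k - 1", unfolded eq] a0]
      by (simp only: B_def mult_ac)
  qed
  have "B 1 = a" using d by (simp add: B_def origin_walk_unfolded walk_weight_def visits_conv_filter)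
  have pos': "0 < B (Suc k)" for k
  proof (induction k)
    case (Suc k)
    then have "0 < B 1 * B (Suc k)" using \<open>B 1 = a\<close> a by simp
    then show ?case using super[of 1 "Suc k"] by simp
  qed (use \<open>B 1 = a\<close> a in simp)
  then have pos: "0 < B k" if "0 < k" for k using that by (cases k) auto
  have A_ge: "B (n + 1) / a \<le> A_plus d n a" for n
    using walk_weight_mono[OF a0 _ unfolded_walks_subset] a
    by (simp add: B_def A_plus_eq_walk_weight)
  have A_pos: "0 < A_plus d n a" for n
    using A_ge[of n] pos[of "n + 1"] a by (meson add_gr_0 divide_pos_pos less_le_trans zero_less_one)
  \<comment> \<open>\<open>M\<close> also dominates \<open>a\<close>, so that the factor
    \<open>a\<close> in \<open>B k\<close> counts as one further step.\<close>
  define M where "M = 2 * real d * max 1 a"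
  have M: "a \<le> M" "0 < M"
  proof -
    have "1 * max 1 a \<le> M" unfolding M_def using d by (intro mult_right_mono) auto
    then show "a \<le> M" "0 < M" using a by auto
  qed
  have "ln (B k) \<le> ln M * real k" if "0 < k" for k
  proof -
    have "B k \<le> a * A_plus d (k - 1) a"
      using A_ge[of "k - 1"] that a by (simp add: field_simps)
    also have "\<dots> \<le> M * M ^ (k - 1)"
      using M a A_plus_le[OF a0, of d "k - 1"] A_pos[of "k - 1"] by (intro mult_mono) (auto simp: M_def)
    also have "\<dots> = M ^ k" using that by (cases k) auto
    finally have "ln (B k) \<le> ln (M ^ k)" using pos[OF that] M by (subst ln_le_cancel_iff) auto
    then show ?thesis using M by (simp add: ln_realpow mult.commute)
  qed
  moreover have "ln (B j) + ln (B k) \<le> ln (B (j + k))" if "0 < j" "0 < k" for j k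
  proof -
    have "ln (B j * B k) \<le> ln (B (j + k))"
      using super[OF that] pos that by (subst ln_le_cancel_iff) auto
    then show ?thesis using pos[OF that(1)] pos[OF that(2)] by (simp add: ln_mult)
  qed
  ultimately obtain l where l: "(\<lambda>k. ln (B k) / real k) \<longlonglongrightarrow> l"
    using fekete_superadditive[of "\<lambda>k. ln (B k)"] by blast
  \<comment> \<open>The class of height \<open>h\<close> is joined to itself; the resulting bound no
    longer depends on \<open>h\<close>.\<close>
  have U_le: "walk_weight d a (unfolded_walks d n h) \<le> sqrt (B (2 * n + 2)) / a" for n h
  proof -
    have "(a * walk_weight d a (unfolded_walks d n h))\<^sup>2 \<le> B (2 * n + 2)"
      using mult_left_mono[OF walk_weight_unfolded_mult_le[OF d a0, of n h n] a0]
      by (simp add: B_def power2_eq_square mult_ac mult_2_right)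
    then have "a * walk_weight d a (unfolded_walks d n h) \<le> sqrt (B (2 * n + 2))"
      by (rule real_le_rsqrt)
    then show ?thesis using a by (simp add: field_simps)
  qed
  \<comment> \<open>Logarithm of the subexponential losses: the number of codes, the n + 1 heights
    (one more power of n + 1) and the factor 1 / a.\<close>
  define F where "F n = ln 2 + (2 * sqrt (2 * real n) + 2) * ln (real n + 1) - ln a" for n
  have A_le: "ln (A_plus d n a) \<le> F n + ln (B (2 * n + 2)) / 2" for n
  proof -
    define S where "S = sqrt (B (2 * n + 2))"
    have S: "0 < S" using pos[of "2 * n + 2"] by (simp add: S_def)
    have "(\<Sum>h\<le>n. walk_weight d a (unfolded_walks d n h)) \<le> (\<Sum>h\<le>n. S / a)"
      unfolding S_def by (rule sum_mono) (rule U_le)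
    then have "(\<Sum>h\<le>n. walk_weight d a (unfolded_walks d n h)) \<le> (real n + 1) * (S / a)"
      by (simp add: add.commute)
    then have "A_plus d n a \<le> (2 * (real n + 1) powr (2 * sqrt (2 * n) + 1)) * ((real n + 1) * (S / a))"
      using A_plus_le_unfolded[OF d a0, of n] card_unfolding_codes_le[of n] a0
      by (intro order_trans[OF A_plus_le_unfolded[OF d a0]] mult_mono)
        (auto intro!: sum_nonneg walk_weight_nonneg)
    then have "ln (A_plus d n a) \<le> ln ((2 * (real n + 1) powr (2 * sqrt (2 * n) + 1)) * ((real n + 1) * (S / a)))"
      using A_pos[of n] S a by (subst ln_le_cancel_iff) auto
    also have "\<dots> = F n + ln S"
    proof -
      have "ln ((2 * p powr e) * (p * (S / a))) = ln 2 + e * ln p + (ln p + (ln S - ln a))"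
        if "0 < p" for p e :: real
        using that S a by (simp add: ln_mult ln_div ln_powr)
      from this[of "real n + 1" "2 * sqrt (2 * n) + 1"] show ?thesis
        by (simp add: F_def distrib_right)
    qed
    also have "ln S = ln (B (2 * n + 2)) / 2" using pos[of "2 * n + 2"] by (simp add: S_def ln_sqrt)
    finally show ?thesis .
  qed
  have cancel: "X / (real n + 1) * ((real n + 1) / q) = X / q" for X q :: real and n :: nat
  proof -
    have "real n + 1 \<noteq> 0" by linarith
    then show ?thesis by simp
  qed
  have "(\<lambda>n. ln (A_plus d n a) / real n) \<longlonglongrightarrow> l"
  proof (rule tendsto_sandwich)
    show "\<forall>\<^sub>F n in sequentially.
        ln (B (n + 1)) / real (n + 1) * ((real n + 1) / real n) - ln a / real n \<le> ln (A_plus d n a) / real n"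
    proof (rule eventually_sequentiallyI[of 1])
      fix n :: nat assume n: "1 \<le> n"
      have "ln (B (n + 1) / a) \<le> ln (A_plus d n a)"
        using A_ge[of n] A_pos[of n] pos[of "n + 1"] a by (subst ln_le_cancel_iff) auto
      then have "(ln (B (n + 1)) - ln a) / n \<le> ln (A_plus d n a) / n"
        using pos[of "n + 1"] a by (intro divide_right_mono) (auto simp: ln_div)
      moreover have "real (n + 1) = real n + 1" by simp
      ultimately show "ln (B (n + 1)) / real (n + 1) * ((real n + 1) / real n) - ln a / real n
          \<le> ln (A_plus d n a) / real n"
        by (simp only: cancel diff_divide_distrib)
    qed
    show "\<forall>\<^sub>F n in sequentially. ln (A_plus d n a) / real n
        \<le> F n / real n + ln (B (2 * n + 2)) / real (2 * n + 2) * ((real n + 1) / real n)"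
    proof (rule eventually_sequentiallyI[of 1])
      fix n :: nat assume n: "1 \<le> n"
      show "ln (A_plus d n a) / real n
        \<le> F n / real n + ln (B (2 * n + 2)) / real (2 * n + 2) * ((real n + 1) / real n)"
      proof -
        have "ln (A_plus d n a) / n \<le> (F n + ln (B (2 * n + 2)) / 2) / n"
          using A_le[of n] by (rule divide_right_mono) simp
        also have "\<dots> = F n / n + ln (B (2 * n + 2)) / 2 / n" by (rule add_divide_distrib)
        finally have "ln (A_plus d n a) / n \<le> F n / n + ln (B (2 * n + 2)) / 2 / n" .
        moreover have "ln (B (2 * n + 2)) / real (2 * n + 2) = ln (B (2 * n + 2)) / 2 / (real n + 1)"
          by (simp add: field_simps)
        ultimately show ?thesis by (simp only: cancel)
      qed
    qed
    have r: "(\<lambda>n. (real n + 1) / real n) \<longlonglongrightarrow> 1" by real_asymp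
    have "(\<lambda>n. ln (B (n + 1)) / real (n + 1)) \<longlonglongrightarrow> l"
      using LIMSEQ_ignore_initial_segment[OF l, of 1] .
    from tendsto_diff[OF tendsto_mult[OF this r] lim_const_over_n[of "ln a"]]
    show "(\<lambda>n. ln (B (n + 1)) / real (n + 1) * ((real n + 1) / real n) - ln a / real n) \<longlonglongrightarrow> l"
      by simp
    have "filterlim (\<lambda>n::nat. 2 * n + 2) sequentially sequentially" by real_asymp
    from filterlim_compose[OF l this]
    have "(\<lambda>n. ln (B (2 * n + 2)) / real (2 * n + 2)) \<longlonglongrightarrow> l" .
    moreover have "(\<lambda>n. F n / real n) \<longlonglongrightarrow> 0" unfolding F_def by real_asymp
    ultimately have "(\<lambda>n. F n / real n + ln (B (2 * n + 2)) / real (2 * n + 2) * ((real n + 1) / real n))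
        \<longlonglongrightarrow> 0 + l * 1"
      using r by (intro tendsto_intros)
    then show "(\<lambda>n. F n / real n + ln (B (2 * n + 2)) / real (2 * n + 2) * ((real n + 1) / real n)) \<longlonglongrightarrow> l"
      by simp
  qed
  then show ?thesis using A_pos by blast
qed

section \<open>Power sums of the normalised zeros\<close>

text \<open>The map w / (2 M - w) takes the half-plane Re w < M into the unit disc and fixes 0, so
  Schwarz's lemma applies to its composition with \<open>f\<close>; solving for \<open>f z\<close>
  gives the estimate.\<close>

lemma borel_caratheodory_unit_disc:
  assumes holf: "f holomorphic_on ball 0 1" and f0: "f 0 = 0"
    and Re_less: "\<And>z. cmod z < 1 \<Longrightarrow> Re (f z) < M" and z: "cmod z < 1"
  shows "cmod (f z) * (1 - cmod z) \<le> 2 * M * cmod z"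
proof -
  have M: "0 < M" using Re_less[of 0] f0 by simp
  define g where "g w = f w / (2 * M - f w)" for w
  have less: "cmod (f w) < cmod (2 * M - f w)" if "cmod w < 1" for w
  proof -
    have "0 < 4 * M * (M - Re (f w))" using M Re_less[OF that] by simp
    then have "(cmod (f w))\<^sup>2 < (cmod (2 * M - f w))\<^sup>2"
      unfolding cmod_power2 by (simp add: power2_eq_square algebra_simps)
    then show ?thesis by (simp add: power2_less_imp_less)
  qed
  have nz: "2 * complex_of_real M - f w \<noteq> 0" if "cmod w < 1" for w
    using less[OF that] by auto
  have "g holomorphic_on ball 0 1"
    unfolding g_def using nz by (intro holomorphic_intros holf) auto
  moreover have "g 0 = 0" by (simp add: g_def f0)
  moreover have "cmod (g w) < 1" if "cmod w < 1" for w
    using less[OF that] nz[OF that] by (simp add: g_def norm_divide divide_less_eq)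
  ultimately have "cmod (g z) \<le> cmod z" using Schwarz_Lemma(1) z by blast
  then have "cmod (f z) \<le> cmod z * cmod (2 * M - f z)"
    using nz[OF z] by (simp add: g_def norm_divide divide_le_eq)
  also have "\<dots> \<le> cmod z * (2 * M + cmod (f z))"
    using norm_triangle_ineq4[of "2 * complex_of_real M" "f z"] M
    by (intro mult_left_mono) (auto simp: norm_mult)
  finally show ?thesis by (simp add: algebra_simps)
qed

text \<open>At 0 the formula yields -k! times the power sum of exponent k + 1; all of the disc is
  covered so that the induction can differentiate again. As |\<zeta> i| = 1, each 1 - \<zeta> i * z
  has positive real part there, which keeps the principal logarithm differentiable.\<close>

lemma higher_deriv_sum_Ln:
  fixes \<zeta> :: "'i \<Rightarrow> complex"
  assumes "finite I" and unit: "\<And>i. i \<in> I \<Longrightarrow> cmod (\<zeta> i) = 1" and "cmod z < 1"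
  shows "(deriv ^^ Suc k) (\<lambda>z. \<Sum>i\<in>I. Ln (1 - \<zeta> i * z)) z
      = - (\<Sum>i\<in>I. fact k * \<zeta> i ^ Suc k / (1 - \<zeta> i * z) ^ Suc k)"
  using \<open>cmod z < 1\<close>
proof (induction k arbitrary: z)
  have pos: "0 < Re (1 - \<zeta> i * z)" if "i \<in> I" "cmod z < 1" for i z
  proof -
    have "Re (\<zeta> i * z) \<le> cmod (\<zeta> i * z)" by (rule complex_Re_le_cmod)
    then show ?thesis using that unit by (simp add: norm_mult)
  qed
  {
    case 0
    have "((\<lambda>z. \<Sum>i\<in>I. Ln (1 - \<zeta> i * z)) has_field_derivative (\<Sum>i\<in>I. - \<zeta> i / (1 - \<zeta> i * z))) (at z)"
    proof (rule DERIV_sum)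
      fix i assume i: "i \<in> I"
      have "1 - \<zeta> i * z \<notin> \<real>\<^sub>\<le>\<^sub>0" using pos[OF i 0] by (auto simp: complex_nonpos_Reals_iff)
      then show "((\<lambda>z. Ln (1 - \<zeta> i * z)) has_field_derivative - \<zeta> i / (1 - \<zeta> i * z)) (at z)"
        by (auto intro!: derivative_eq_intros simp: field_simps)
    qed
    then show ?case by (simp add: DERIV_imp_deriv sum_negf)
  next
    case (Suc k)
    have nz: "1 - \<zeta> i * z \<noteq> 0" if "i \<in> I" for i
      using pos[OF that Suc.prems] by (metis less_irrefl zero_complex.sel(1))
    have D: "((\<lambda>z. - (\<Sum>i\<in>I. fact k * \<zeta> i ^ Suc k / (1 - \<zeta> i * z) ^ Suc k)) has_field_derivative
        - (\<Sum>i\<in>I. fact (Suc k) * \<zeta> i ^ Suc (Suc k) / (1 - \<zeta> i * z) ^ Suc (Suc k))) (at z)"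
    proof (intro DERIV_minus DERIV_sum)
      fix i assume i: "i \<in> I"
      have "((\<lambda>z. 1 - \<zeta> i * z) has_field_derivative - \<zeta> i) (at z)"
        by (auto intro!: derivative_eq_intros)
      from DERIV_power_Suc[OF this, of k]
      have "((\<lambda>z. (1 - \<zeta> i * z) ^ Suc k) has_field_derivative
          (1 + of_nat k) * (- \<zeta> i * (1 - \<zeta> i * z) ^ k)) (at z)" .
      note D = DERIV_cmult[OF DERIV_inverse'[OF this], of "fact k * \<zeta> i ^ Suc k"]
      have "c * c ^ k * fact k * - (inverse (q ^ Suc k) * ((1 + of_nat k) * (- c * q ^ k)) * inverse (q ^ Suc k))
          = fact (Suc k) * c ^ Suc (Suc k) / q ^ Suc (Suc k)" if "q \<noteq> 0" for q c :: complex
        using that by (simp add: field_simps)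
      from this[OF nz[OF i], of "\<zeta> i"] D nz[OF i]
      show "((\<lambda>z. fact k * \<zeta> i ^ Suc k / (1 - \<zeta> i * z) ^ Suc k) has_field_derivative
          fact (Suc k) * \<zeta> i ^ Suc (Suc k) / (1 - \<zeta> i * z) ^ Suc (Suc k)) (at z)"
        by (simp add: divide_inverse mult_ac)
    qed
    have "((deriv ^^ Suc k) (\<lambda>z. \<Sum>i\<in>I. Ln (1 - \<zeta> i * z)) has_field_derivative
        - (\<Sum>i\<in>I. fact (Suc k) * \<zeta> i ^ Suc (Suc k) / (1 - \<zeta> i * z) ^ Suc (Suc k))) (at z)"
      by (rule has_field_derivative_transform_within_open[OF D, of "ball 0 1"])
        (use Suc in auto)
    then show ?case by (simp add: DERIV_imp_deriv)
  }
qed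

text \<open>The constant is (k + 1)! / k! * 2 M' * 2 ^ (k + 1): Borel-Caratheodory bounds the sum of
  logarithms by 2 M' on the circle of radius 1/2, Cauchy's inequality there bounds the derivative,
  and k! cancels. The strict \<open>M < M'\<close> supplies the strict bound on the real
  part.\<close>

lemma power_sum_le_of_prod_bound:
  fixes \<zeta> :: "'i \<Rightarrow> complex"
  assumes fin: "finite I" and unit: "\<And>i. i \<in> I \<Longrightarrow> cmod (\<zeta> i) = 1"
    and bound: "\<And>u. cmod u = 1 \<Longrightarrow> (\<Prod>i\<in>I. cmod (u - \<zeta> i)) \<le> exp M" and "M < M'"
  shows "cmod (\<Sum>i\<in>I. \<zeta> i ^ Suc k) \<le> 2 ^ (k + 2) * real (Suc k) * M'"
proof -
  define f where "f = (\<lambda>z. \<Sum>i\<in>I. Ln (1 - \<zeta> i * z))"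
  have pos: "0 < Re (1 - \<zeta> i * z)" if "i \<in> I" "cmod z < 1" for i z
  proof -
    have "Re (\<zeta> i * z) \<le> cmod (\<zeta> i * z)" by (rule complex_Re_le_cmod)
    then show ?thesis using that unit by (simp add: norm_mult)
  qed
  have holf: "f holomorphic_on ball 0 1"
    unfolding f_def
  proof (intro holomorphic_on_sum)
    fix i assume "i \<in> I"
    then have "1 - \<zeta> i * z \<notin> \<real>\<^sub>\<le>\<^sub>0" if "z \<in> ball 0 1" for z
      using pos[of i z] that by (auto simp: complex_nonpos_Reals_iff)
    then show "(\<lambda>z. Ln (1 - \<zeta> i * z)) holomorphic_on ball 0 1" by (intro holomorphic_intros)
  qed
  \<comment> \<open>For |w| = 1 the factor 1 - \<zeta> i * w has the modulus of cnj w - \<zeta> i,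
    so the bound on the circle extends inwards by the maximum principle.\<close>
  have prod_le: "cmod (\<Prod>i\<in>I. 1 - \<zeta> i * z) \<le> exp M" if "z \<in> cball 0 1" for z
  proof (rule maximum_modulus_frontier[of "\<lambda>z. \<Prod>i\<in>I. 1 - \<zeta> i * z" "cball 0 1"])
    fix w assume "w \<in> frontier (cball 0 (1::real) :: complex set)"
    then have w: "cmod w = 1" by simp
    have "cmod (1 - \<zeta> i * w) = cmod (cnj w - \<zeta> i)" for i
    proof -
      have "w * cnj w = 1" using w by (simp add: complex_norm_square[symmetric])
      then have "1 - \<zeta> i * w = w * (cnj w - \<zeta> i)" by (simp add: algebra_simps)
      then show ?thesis using w by (simp add: norm_mult)
    qed
    then show "cmod (\<Prod>i\<in>I. 1 - \<zeta> i * w) \<le> exp M" using bound[of "cnj w"] w by (simp add: prod_norm[symmetric])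
  qed (use that in \<open>auto intro!: holomorphic_intros continuous_intros\<close>)
  have Re_less: "Re (f z) < M'" if z: "cmod z < 1" for z
  proof -
    have nz: "1 - \<zeta> i * z \<noteq> 0" if "i \<in> I" for i
      using pos[OF that z] by (metis less_irrefl zero_complex.sel(1))
    have "exp (f z) = (\<Prod>i\<in>I. 1 - \<zeta> i * z)"
      unfolding f_def exp_sum[OF fin] by (rule prod.cong) (use nz in auto)
    then have "exp (Re (f z)) \<le> exp M" using prod_le[of z] z norm_exp_eq_Re[of "f z"] by simp
    then show ?thesis using \<open>M < M'\<close> by simp
  qed
  have half: "cmod (f z) \<le> 2 * M'" if "cmod (0 - z) = 1/2" for z
  proof -
    have c: "cmod z = 1/2" using that by simp
    have "cmod (f z) * (1 - cmod z) \<le> 2 * M' * cmod z"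
      by (rule borel_caratheodory_unit_disc[OF holf _ Re_less]) (auto simp: f_def c)
    then show ?thesis unfolding c by (simp add: field_simps)
  qed
  have "cmod ((deriv ^^ Suc k) f 0) \<le> fact (Suc k) * (2 * M') / (1/2) ^ Suc k"
  proof (rule Cauchy_inequality[OF _ _ _ half])
    show "f holomorphic_on ball 0 (1/2)" by (rule holomorphic_on_subset[OF holf]) auto
    show "continuous_on (cball 0 (1/2)) f"
      by (rule holomorphic_on_imp_continuous_on[OF holomorphic_on_subset[OF holf]]) auto
  qed auto
  moreover have "(deriv ^^ Suc k) f 0 = - (fact k * (\<Sum>i\<in>I. \<zeta> i ^ Suc k))"
    unfolding f_def by (subst higher_deriv_sum_Ln[OF fin unit]) (auto simp: sum_distrib_left)
  ultimately have "fact k * cmod (\<Sum>i\<in>I. \<zeta> i ^ Suc k) \<le> fact k * (2 ^ (k + 2) * real (Suc k) * M')"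
    by (simp add: norm_mult power_divide algebra_simps del: of_nat_Suc)
  then show ?thesis by (simp only: mult_le_cancel_left_pos[OF fact_gt_zero])
qed

text \<open>Schur's observation: moving a zero radially onto the circle decreases, after
  normalisation, the modulus on the circle.\<close>

lemma cmod_diff_sgn_le:
  assumes "t \<noteq> 0" "cmod u = 1" "0 < R"
  shows "R * cmod t * (cmod (u - sgn t))\<^sup>2 \<le> (cmod (R * u - t))\<^sup>2"
proof -
  define r where "r = cmod t"
  define c where "c = Re (u * cnj (sgn t))"
  have t: "t = r * sgn t" using assms by (simp add: r_def sgn_eq)
  have sq: "(cmod (x * u - y * sgn t))\<^sup>2 = x\<^sup>2 + y\<^sup>2 - 2 * x * y * c" for x y :: real
  proof -
    have "(Re u)\<^sup>2 + (Im u)\<^sup>2 = 1" "(Re (sgn t))\<^sup>2 + (Im (sgn t))\<^sup>2 = 1"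
      unfolding cmod_power2[symmetric] using assms by (simp_all add: norm_sgn)
    moreover have "(cmod (x * u - y * sgn t))\<^sup>2 = x\<^sup>2 * ((Re u)\<^sup>2 + (Im u)\<^sup>2)
        + y\<^sup>2 * ((Re (sgn t))\<^sup>2 + (Im (sgn t))\<^sup>2) - 2 * x * y * c"
      unfolding cmod_power2 by (simp add: c_def power2_eq_square algebra_simps)
    ultimately show ?thesis by simp
  qed
  \<comment> \<open>The difference of the two sides of the claim is exactly this square.\<close>
  have "0 \<le> (R - r)\<^sup>2" by simp
  then have "R * r * (1 + 1 - 2 * c) \<le> R\<^sup>2 + r\<^sup>2 - 2 * R * r * c"
    by (simp add: power2_eq_square algebra_simps)
  then show ?thesis using sq[of 1 1] sq[of R r] t by (simp add: r_def)
qed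

text \<open>Multiplying \<open>cmod_diff_sgn_le\<close> over all zeros and using
  \<open>b 0 = b N * (\<Prod>i<N. cmod (t i))\<close> gives
  \<open>b 0 * (b N * R ^ N) * Q\<^sup>2 \<le> S\<^sup>2\<close>, where \<open>Q\<close> is the
  product to be bounded and \<open>S\<close>, the value at \<open>R\<close>, bounds the polynomial
  on the circle of radius \<open>R\<close>. Taking logarithms finishes the proof.\<close>

lemma prod_cmod_diff_sgn_roots_le:
  fixes b :: "nat \<Rightarrow> real" and t :: "nat \<Rightarrow> complex"
  assumes b: "\<And>n. 0 < b n" and R: "0 < R" and u: "cmod u = 1"
    and P: "(\<Sum>n\<le>N. monom (complex_of_real (b n)) n) = smult (of_real (b N)) (\<Prod>i<N. [:- t i, 1:])"
  shows "(\<Prod>i<N. cmod (u - sgn (t i)))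
     \<le> exp (ln (\<Sum>n\<le>N. b n * R ^ n) - (ln (b 0) + ln (b N * R ^ N)) / 2)"
proof -
  define S where "S = (\<Sum>n\<le>N. b n * R ^ n)"
  have poly_eq: "(\<Sum>n\<le>N. of_real (b n) * z ^ n) = of_real (b N) * (\<Prod>i<N. z - t i)" for z
    using arg_cong[OF P, of "\<lambda>p. poly p z"] by (simp add: poly_sum poly_monom poly_prod)
  have "complex_of_real (b 0) = of_real (b N) * (\<Prod>i<N. - t i)"
    using poly_eq[of 0] by (simp add: power_0_left sum.delta if_distrib cong: if_cong)
  have b0: "b 0 = b N * (\<Prod>i<N. cmod (t i))"
  proof -
    have "cmod (of_real (b 0)) = cmod (of_real (b N) * (\<Prod>i<N. - t i))"
      using \<open>complex_of_real (b 0) = of_real (b N) * (\<Prod>i<N. - t i)\<close> by simp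
    then show ?thesis using b[of 0] b[of N] by (simp add: norm_mult prod_norm[symmetric])
  qed
  have nz: "t i \<noteq> 0" if "i < N" for i
  proof
    assume "t i = 0"
    then have "(\<Prod>i<N. cmod (t i)) = 0" using that by (intro prod_zero) auto
    then show False using b0 b[of 0] by (metis less_irrefl mult_zero_right)
  qed
  have S: "0 < S" unfolding S_def using b R by (intro sum_pos) auto
  define Q where "Q = (\<Prod>i<N. cmod (u - sgn (t i)))"
  have "cmod (of_real (b N) * (\<Prod>i<N. R * u - t i)) \<le> S"
    unfolding poly_eq[symmetric] S_def
    using b R u by (intro sum_norm_le) (simp add: norm_mult norm_power abs_of_pos)
  then have "(b N * (\<Prod>i<N. cmod (R * u - t i)))\<^sup>2 \<le> S\<^sup>2"
    using b[of N] by (intro power_mono) (auto simp: norm_mult prod_norm intro!: mult_nonneg_nonneg prod_nonneg)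
  moreover have "(\<Prod>i<N. R * cmod (t i) * (cmod (u - sgn (t i)))\<^sup>2) \<le> (\<Prod>i<N. (cmod (R * u - t i))\<^sup>2)"
    using nz u R by (intro prod_mono) (auto intro!: cmod_diff_sgn_le mult_nonneg_nonneg)
  then have "(b N)\<^sup>2 * (R ^ N * (\<Prod>i<N. cmod (t i)) * Q\<^sup>2) \<le> (b N * (\<Prod>i<N. cmod (R * u - t i)))\<^sup>2"
    by (simp add: Q_def prod.distrib prod_power_distrib power_mult_distrib mult_left_mono)
  moreover have "(b N)\<^sup>2 * (R ^ N * (\<Prod>i<N. cmod (t i)) * Q\<^sup>2) = b 0 * (b N * R ^ N) * Q\<^sup>2"
    using b0 by (simp add: power2_eq_square)
  ultimately have le: "b 0 * (b N * R ^ N) * Q\<^sup>2 \<le> S\<^sup>2" by simp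
  show ?thesis
  \<comment> \<open>If \<open>u\<close> is one of the normalised zeros, \<open>Q\<close> vanishes
    and logarithms are of no use, but the claim is trivial.\<close>
  proof (cases "Q = 0")
    case False
    then have Q: "0 < Q" by (simp add: Q_def less_le prod_nonneg)
    have "ln (b 0 * (b N * R ^ N) * Q\<^sup>2) \<le> ln (S\<^sup>2)"
      using le b[of 0] b[of N] R Q S by (subst ln_le_cancel_iff) auto
    then have "ln (b 0) + ln (b N * R ^ N) + 2 * ln Q \<le> 2 * ln S"
      using b[of 0] b[of N] R Q S by (simp add: ln_mult ln_realpow)
    then have "ln Q \<le> ln S - (ln (b 0) + ln (b N * R ^ N)) / 2" by (simp add: field_simps)
    then have "exp (ln Q) \<le> exp (ln S - (ln (b 0) + ln (b N * R ^ N)) / 2)"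
      by (simp only: exp_le_cancel_iff)
    then show ?thesis unfolding Q_def[symmetric] S_def[symmetric] using Q by simp
  qed (simp add: Q_def[symmetric])
qed

section \<open>Weyl's criterion on the unit circle\<close>

text \<open>Values off the unit circle are unconstrained. Nonnegative exponents suffice, because on
  the circle a term Re (c / z ^ k) equals Re (cnj c * z ^ k).\<close>

inductive trig_poly :: "(complex \<Rightarrow> real) \<Rightarrow> bool" where
  monomial: "(\<And>z. cmod z = 1 \<Longrightarrow> g z = Re (c * z ^ k)) \<Longrightarrow> trig_poly g"
| add: "trig_poly f \<Longrightarrow> trig_poly g \<Longrightarrow> (\<And>z. cmod z = 1 \<Longrightarrow> h z = f z + g z) \<Longrightarrow> trig_poly h"

text \<open>Re p * Re q is half of Re (p * q) + Re (p * cnj q), and on the circle conjugation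
  inverts z ^ l; \<open>l \<le> k\<close> keeps the exponent k - l natural.\<close>

lemma trig_poly_monomial_mult_monomial:
  assumes "l \<le> k" "\<And>z. cmod z = 1 \<Longrightarrow> h z = Re (c * z ^ k) * Re (e * z ^ l)"
  shows "trig_poly h"
proof (rule trig_poly.add)
  show "trig_poly (\<lambda>z. Re (c * e / 2 * z ^ (k + l)))" by (rule trig_poly.monomial) (rule refl)
  show "trig_poly (\<lambda>z. Re (c * cnj e / 2 * z ^ (k - l)))" by (rule trig_poly.monomial) (rule refl)
  fix z :: complex assume z: "cmod z = 1"
  have "z * cnj z = 1" using z by (simp add: complex_norm_square[symmetric])
  then have "z ^ l * cnj z ^ l = 1" by (simp flip: power_mult_distrib)
  then have k: "z ^ (k - l) = z ^ k * cnj (z ^ l)"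
    using assms(1) power_add[of z "k - l" l] by (simp add: mult.assoc)
  have "Re p * Re q = Re (p * q) / 2 + Re (p * cnj q) / 2" for p q :: complex
    by (simp add: field_simps)
  then have "Re (c * z ^ k) * Re (e * z ^ l)
      = Re ((c * z ^ k) * (e * z ^ l)) / 2 + Re ((c * z ^ k) * cnj (e * z ^ l)) / 2" .
  also have "\<dots> = Re (c * e / 2 * z ^ (k + l)) + Re (c * cnj e / 2 * z ^ (k - l))"
  proof -
    have "c * e / 2 * z ^ (k + l) = (c * z ^ k) * (e * z ^ l) / 2" by (simp add: power_add)
    moreover have "c * cnj e / 2 * z ^ (k - l) = (c * z ^ k) * cnj (e * z ^ l) / 2" by (simp add: k)
    ultimately show ?thesis by (simp only: Re_divide_numeral)
  qed
  finally show "h z = Re (c * e / 2 * z ^ (k + l)) + Re (c * cnj e / 2 * z ^ (k - l))"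
    using assms(2) z by simp
qed

lemma trig_poly_mult:
  assumes "trig_poly f" "trig_poly g"
  shows "trig_poly (\<lambda>z. f z * g z)"
  using assms(1)
proof (induction rule: trig_poly.induct)
  case (monomial f c k)
  show ?case using assms(2)
  proof (induction rule: trig_poly.induct)
    case (monomial g e l)
    note f = \<open>\<And>z. cmod z = 1 \<Longrightarrow> f z = Re (c * z ^ k)\<close>
    show ?case
    proof (cases "l \<le> k")
      case True
      then show ?thesis
        by (rule trig_poly_monomial_mult_monomial[of _ _ _ c e]) (simp add: f monomial)
    next
      case False
      then show ?thesis
        by (intro trig_poly_monomial_mult_monomial[of k l _ e c]) (simp_all add: f monomial)
    qed
  next
    case (add g1 g2 h)
    show ?case by (rule trig_poly.add[OF add(4,5)]) (simp add: add distrib_left)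
  qed
next
  case (add f1 f2 h)
  show ?case by (rule trig_poly.add[OF add(4,5)]) (simp add: add distrib_right)
qed

lemma continuous_on_trig_poly:
  assumes "trig_poly g"
  shows "continuous_on (sphere 0 1) g"
  using assms
proof (induction rule: trig_poly.induct)
  case (monomial g c k)
  have "continuous_on (sphere 0 1) (\<lambda>z. Re (c * z ^ k))" by (intro continuous_intros)
  then show ?case by (rule continuous_on_eq) (simp add: monomial)
next
  case (add f g h)
  have "continuous_on (sphere 0 1) (\<lambda>z. f z + g z)" using add by (intro continuous_intros)
  then show ?case by (rule continuous_on_eq) (simp add: add)
qed

lemma trig_poly_dense:
  fixes g :: "complex \<Rightarrow> real"
  assumes "continuous_on (sphere 0 1) g" "0 < e"
  shows "\<exists>h. trig_poly h \<and> (\<forall>z\<in>sphere 0 1. \<bar>g z - h z\<bar> < e)"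
proof (rule Stone_Weierstrass_HOL[where P = trig_poly, OF _ _ _ _ _ _ assms])
  show "trig_poly (\<lambda>z. c)" for c by (rule trig_poly.monomial[of _ "of_real c" 0]) simp
  show "trig_poly (\<lambda>z. f z + g z)" if "trig_poly f \<and> trig_poly g" for f g
    using that by (auto intro: trig_poly.add)
  show "\<exists>f. trig_poly f \<and> f x \<noteq> f y" if "x \<in> sphere 0 1 \<and> y \<in> sphere 0 1 \<and> x \<noteq> y" for x y :: complex
  proof (cases "Re x = Re y")
    case True
    then have "Im x \<noteq> Im y" using that complex_eqI by blast
    moreover have "trig_poly Im" by (rule trig_poly.monomial[of _ "-\<i>" 1]) simp
    ultimately show ?thesis by blast
  next
    case False
    moreover have "trig_poly Re" by (rule trig_poly.monomial[of _ 1 1]) simp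
    ultimately show ?thesis by blast
  qed
qed (auto simp: trig_poly_mult continuous_on_trig_poly)

section \<open>From vanishing power means to arc frequencies\<close>

definition circle_mean :: "(complex \<Rightarrow> real) \<Rightarrow> real" where
  "circle_mean g = integral {-pi..pi} (\<lambda>t. g (cis t)) / (2 * pi)"

lemma circle_integrable:
  fixes g :: "complex \<Rightarrow> real"
  assumes "continuous_on (sphere 0 1) g"
  shows "(\<lambda>t. g (cis t)) integrable_on {a..b}"
  by (intro integrable_continuous_real continuous_on_compose2[OF assms] continuous_intros) auto

text \<open>For k > 0 the antiderivative has the same value at both ends of the full period.\<close>

lemma circle_mean_monomial:
  assumes "\<And>z. cmod z = 1 \<Longrightarrow> g z = Re (c * z ^ k)"
  shows "circle_mean g = (if k = 0 then Re c else 0)"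
proof (cases "k = 0")
  case True
  then have "integral {-pi..pi} (\<lambda>t. g (cis t)) = integral {-pi..pi} (\<lambda>t. Re c)"
    using assms by (intro integral_cong) simp
  then show ?thesis using True by (simp add: circle_mean_def)
next
  case False
  have "((\<lambda>t. Re (c * cis (real k * t))) has_integral
      (Re (c * cis (real k * pi) / (\<i> * k)) - Re (c * cis (real k * (-pi)) / (\<i> * k)))) {-pi..pi}"
  proof (rule fundamental_theorem_of_calculus)
    fix t :: real
    have "((\<lambda>t. Re (c * cis (real k * t) / (\<i> * k))) has_field_derivative Re (c * cis (real k * t)))
        (at t within {-pi..pi})"
      using False
      by (auto simp: Re_divide cmod_def power2_eq_square field_simps intro!: derivative_eq_intros)
    then show "((\<lambda>t. Re (c * cis (real k * t) / (\<i> * k))) has_vector_derivative Re (c * cis (real k * t)))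
        (at t within {-pi..pi})"
      by (simp add: has_real_derivative_iff_has_vector_derivative)
  qed simp
  moreover have "cis (real k * (-pi)) = cis (real k * pi)"
    by (simp add: complex_eq_iff)
  ultimately have "integral {-pi..pi} (\<lambda>t. Re (c * cis (real k * t))) = 0"
    by (simp add: integral_unique)
  moreover have "integral {-pi..pi} (\<lambda>t. g (cis t)) = integral {-pi..pi} (\<lambda>t. Re (c * cis (real k * t)))"
    by (intro integral_cong) (simp only: assms[OF norm_cis] Complex.DeMoivre)
  ultimately show ?thesis using False by (simp add: circle_mean_def)
qed

text \<open>Row N of this triangular array holds N points of the circle; entries with i >= N are
  arbitrary. Negative exponents follow from positive ones by conjugation.\<close>

locale weyl_array =
  fixes \<zeta> :: "nat \<Rightarrow> nat \<Rightarrow> complex"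
  assumes unit: "\<And>N i. i < N \<Longrightarrow> cmod (\<zeta> N i) = 1"
    and power_means: "\<And>k. 0 < k \<Longrightarrow> (\<lambda>N. (\<Sum>i<N. \<zeta> N i ^ k) / of_nat N) \<longlonglongrightarrow> 0"
begin

lemma trig_poly_mean_tendsto:
  assumes "trig_poly g"
  shows "(\<lambda>N. (\<Sum>i<N. g (\<zeta> N i)) / real N) \<longlonglongrightarrow> circle_mean g"
  using assms
proof (induction rule: trig_poly.induct)
  case (monomial g c k)
  have eq: "(\<Sum>i<N. g (\<zeta> N i)) / real N = Re (c * ((\<Sum>i<N. \<zeta> N i ^ k) / of_nat N))" for N
  proof -
    have "(\<Sum>i<N. g (\<zeta> N i)) = (\<Sum>i<N. Re (c * \<zeta> N i ^ k))"
      by (intro sum.cong refl monomial unit) simp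
    also have "\<dots> = Re (c * (\<Sum>i<N. \<zeta> N i ^ k))" by (simp only: Re_sum sum_distrib_left)
    finally show ?thesis by (simp only: times_divide_eq_right Re_divide_of_nat)
  qed
  have mean: "circle_mean g = (if k = 0 then Re c else 0)"
    by (rule circle_mean_monomial) (rule monomial)
  show ?case
  proof (cases "k = 0")
    case True
    have "\<forall>\<^sub>F N in sequentially. (\<Sum>i<N. g (\<zeta> N i)) / real N = Re c"
      unfolding eq by (rule eventually_sequentiallyI[of 1]) (simp add: True)
    then show ?thesis
      using mean True by (simp add: tendsto_eventually)
  next
    case False
    then have "(\<lambda>N. Re (c * ((\<Sum>i<N. \<zeta> N i ^ k) / of_nat N))) \<longlonglongrightarrow> Re (c * 0)"
      using power_means[of k] by (intro tendsto_intros) auto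
    then show ?thesis unfolding eq using mean False by simp
  qed
next
  case (add f g h)
  have "integral {-pi..pi} (\<lambda>t. h (cis t)) = integral {-pi..pi} (\<lambda>t. f (cis t) + g (cis t))"
    using add by (intro integral_cong) simp
  also have "\<dots> = integral {-pi..pi} (\<lambda>t. f (cis t)) + integral {-pi..pi} (\<lambda>t. g (cis t))"
    using add by (intro integral_add circle_integrable continuous_on_trig_poly)
  finally have "circle_mean h = circle_mean f + circle_mean g"
    by (simp add: circle_mean_def add_divide_distrib)
  moreover have "(\<Sum>i<N. h (\<zeta> N i)) / real N = (\<Sum>i<N. f (\<zeta> N i)) / real N + (\<Sum>i<N. g (\<zeta> N i)) / real N" for N
    using unit add by (simp add: sum.distrib add_divide_distrib)
  ultimately show ?case using add by (simp add: tendsto_add)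
qed

text \<open>Replacing \<open>g\<close> by a trigonometric polynomial within e / 3 costs at most e /
  3 in the sample mean and e / 3 in the circle mean.\<close>

lemma continuous_mean_tendsto:
  assumes g: "continuous_on (sphere 0 1) g"
  shows "(\<lambda>N. (\<Sum>i<N. g (\<zeta> N i)) / real N) \<longlonglongrightarrow> circle_mean g"
proof (rule LIMSEQ_I)
  fix e :: real assume e: "0 < e"
  obtain h where h: "trig_poly h" "\<forall>z\<in>sphere 0 1. \<bar>g z - h z\<bar> < e / 3"
    using trig_poly_dense[OF g, of "e / 3"] e by auto
  have "norm (integral {-pi..pi} (\<lambda>t. g (cis t) - h (cis t))) \<le> integral {-pi..pi} (\<lambda>_. e / 3)"
  proof (rule integral_norm_bound_integral)
    show "(\<lambda>t. g (cis t) - h (cis t)) integrable_on {-pi..pi}"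
      by (intro integrable_diff circle_integrable g continuous_on_trig_poly h(1))
  qed (use h(2) in \<open>auto simp: less_imp_le\<close>)
  moreover have "integral {-pi..pi} (\<lambda>t. g (cis t) - h (cis t)) = 2 * pi * (circle_mean g - circle_mean h)"
    using circle_integrable[OF g] circle_integrable[OF continuous_on_trig_poly[OF h(1)]]
    by (simp add: circle_mean_def integral_diff right_diff_distrib)
  ultimately have m: "\<bar>circle_mean g - circle_mean h\<bar> \<le> e / 3"
    by (simp add: abs_mult)
  have a: "\<bar>(\<Sum>i<N. g (\<zeta> N i)) / real N - (\<Sum>i<N. h (\<zeta> N i)) / real N\<bar> \<le> e / 3" for N
  proof -
    have "\<bar>\<Sum>i<N. g (\<zeta> N i) - h (\<zeta> N i)\<bar> \<le> (\<Sum>i<N. e / 3)"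
      using h(2) unit by (intro order_trans[OF sum_abs] sum_mono) (auto simp: less_imp_le)
    then have "\<bar>\<Sum>i<N. g (\<zeta> N i) - h (\<zeta> N i)\<bar> / real N \<le> (real N * (e / 3)) / real N"
      by (intro divide_right_mono) auto
    also have "\<dots> \<le> e / 3" using e by simp
    finally have "\<bar>(\<Sum>i<N. g (\<zeta> N i) - h (\<zeta> N i)) / real N\<bar> \<le> e / 3" by (simp only: abs_divide abs_of_nat)
    then show ?thesis by (simp only: sum_subtractf diff_divide_distrib)
  qed
  obtain N0 where N0: "\<forall>N\<ge>N0. \<bar>(\<Sum>i<N. h (\<zeta> N i)) / real N - circle_mean h\<bar> < e / 3"
    using LIMSEQ_D[OF trig_poly_mean_tendsto[OF h(1)], of "e / 3"] e by auto
  show "\<exists>N0. \<forall>N\<ge>N0. norm ((\<Sum>i<N. g (\<zeta> N i)) / real N - circle_mean g) < e"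
  proof (intro exI[of _ N0] allI impI)
    fix N assume "N0 \<le> N"
    then show "norm ((\<Sum>i<N. g (\<zeta> N i)) / real N - circle_mean g) < e"
      using N0[rule_format, of N] a[of N] m unfolding real_norm_def by argo
  qed
qed

text \<open>A continuous function with values in [0, 1] that vanishes outside the open arc and
  equals 1 on a slightly shorter arc has its sum bounded by the count. As it vanishes at both
  endpoints too, the half-open convention makes no difference.\<close>

lemma arc_frequency_lower:
  assumes "-pi \<le> \<theta>" "\<theta> \<le> \<phi>" "\<phi> \<le> pi" "c < (\<phi> - \<theta>) / (2 * pi)"
  shows "\<forall>\<^sub>F N in sequentially. c < real (card {i. i < N \<and> \<theta> < Arg (\<zeta> N i) \<and> Arg (\<zeta> N i) \<le> \<phi>}) / real N"
proof (cases "c < 0")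
  case True
  then show ?thesis by (intro always_eventually allI) (meson less_le_trans divide_nonneg_nonneg of_nat_0_le_iff)
next
  case False
  \<comment> \<open>The excess of the arc length over 2 pi c is 3 \<delta>; cutting \<delta> off
    both ends leaves 2 pi c + \<delta>. As c is not negative here, the shortened arc is
    nonempty.\<close>
  define \<delta> where "\<delta> = (\<phi> - \<theta> - 2 * pi * c) / 3"
  have \<delta>: "0 < \<delta>" "c < (\<phi> - \<theta> - 2 * \<delta>) / (2 * pi)" "\<theta> + \<delta> \<le> \<phi> - \<delta>"
  proof -
    have *: "0 < \<phi> - \<theta> - 2 * pi * c" using assms(4) by (simp add: field_simps)
    then show "0 < \<delta>" by (simp add: \<delta>_def)
    have "2 * pi * c < \<phi> - \<theta> - 2 * \<delta>" using * by (simp add: \<delta>_def field_simps)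
    then show "c < (\<phi> - \<theta> - 2 * \<delta>) / (2 * pi)" by (simp add: field_simps)
    have "0 \<le> 2 * pi * c" using False by simp
    then show "\<theta> + \<delta> \<le> \<phi> - \<delta>" using \<open>2 * pi * c < \<phi> - \<theta> - 2 * \<delta>\<close> by argo
  qed
  define K where "K = cis ` {\<theta> + \<delta>..\<phi> - \<delta>}"
  define F where "F = cis ` ({-pi..\<theta>} \<union> {\<phi>..pi})"
  have cl: "closedin (top_of_set (sphere 0 1)) K" "closedin (top_of_set (sphere 0 1)) F"
    unfolding K_def F_def
    by (intro closed_subset compact_imp_closed compact_continuous_image continuous_intros compact_Un;
        auto)+
  have "F \<inter> K = {}"
  proof -
    have False if s: "s \<in> {\<theta> + \<delta>..\<phi> - \<delta>}" and t: "t \<in> {-pi..\<theta>} \<union> {\<phi>..pi}" and eq: "cis s = cis t" for s t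
    proof -
      have s': "Arg (cis s) = s" using s assms \<delta> by (intro Arg_cis) auto
      show False
      \<comment> \<open>The angle -pi names the same point as pi but is not a value of
        \<open>Arg\<close>, so it is handled apart.\<close>
      proof (cases "t = -pi")
        case True
        then have "cis t = cis pi" by (simp add: complex_eq_iff)
        moreover have "Arg (cis pi) = pi" by (rule Arg_cis) auto
        ultimately have "s = pi" using s' eq by metis
        then show False using s assms \<delta> by auto
      next
        case False
        then have "Arg (cis t) = t" using t assms by (intro Arg_cis) auto
        then show False using s' eq s t \<delta> by auto
      qed
    qed
    then show ?thesis unfolding K_def F_def disjoint_iff by (metis imageE)
  qed
  then obtain g :: "complex \<Rightarrow> real" where g: "continuous_on (sphere 0 1) g"
      "\<And>x. x \<in> sphere 0 1 \<Longrightarrow> g x \<in> closed_segment 0 1"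
      "\<And>x. x \<in> sphere 0 1 \<Longrightarrow> g x = 0 \<longleftrightarrow> x \<in> F" "\<And>x. x \<in> sphere 0 1 \<Longrightarrow> g x = 1 \<longleftrightarrow> x \<in> K"
    using Urysohn_local_strong[OF cl(2,1), of "0::real" 1] by auto
  have g01: "0 \<le> g x" "g x \<le> 1" if "cmod x = 1" for x
    using g(2)[of x] that by (auto simp: closed_segment_eq_real_ivl)
  have "\<phi> - \<theta> - 2 * \<delta> = integral {\<theta> + \<delta>..\<phi> - \<delta>} (\<lambda>t. 1::real)"
    using \<delta> by simp
  also have "\<dots> = integral {\<theta> + \<delta>..\<phi> - \<delta>} (\<lambda>t. g (cis t))"
    using g(4) by (intro integral_cong) (auto simp: K_def)
  also have "\<dots> \<le> integral {-pi..pi} (\<lambda>t. g (cis t))"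
    using assms \<delta> g01 by (intro integral_subset_le circle_integrable g(1)) auto
  finally have "(\<phi> - \<theta> - 2 * \<delta>) / (2 * pi) \<le> circle_mean g"
    unfolding circle_mean_def by (intro divide_right_mono) auto
  then have "c < circle_mean g" using \<delta>(2) by linarith
  then have "\<forall>\<^sub>F N in sequentially. c < (\<Sum>i<N. g (\<zeta> N i)) / real N"
    using continuous_mean_tendsto[OF g(1)] by (simp add: order_tendstoD)
  then show ?thesis
  proof eventually_elim
    case (elim N)
    let ?A = "{i. i < N \<and> \<theta> < Arg (\<zeta> N i) \<and> Arg (\<zeta> N i) \<le> \<phi>}"
    have "g (\<zeta> N i) \<le> (if i \<in> ?A then 1 else 0)" if "i < N" for i
    proof (cases "i \<in> ?A")
      case True
      then show ?thesis using g01 unit[OF that] by simp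
    next
      case False
      have "cis (Arg (\<zeta> N i)) = \<zeta> N i" using unit[OF that] by (subst cis_Arg) (auto simp: sgn_eq)
      moreover have "Arg (\<zeta> N i) \<in> {-pi..\<theta>} \<union> {\<phi>..pi}"
        using False that mpi_less_Arg[of "\<zeta> N i"] Arg_le_pi[of "\<zeta> N i"] by auto
      ultimately have "\<zeta> N i \<in> F" unfolding F_def by (metis imageI)
      then have "g (\<zeta> N i) = 0" using g(3) unit[OF that] by simp
      then show ?thesis by simp
    qed
    then have "(\<Sum>i<N. g (\<zeta> N i)) \<le> (\<Sum>i<N. if i \<in> ?A then 1 else 0)" by (intro sum_mono) auto
    also have "\<dots> = real (card ?A)"
      by (subst sum.inter_restrict[symmetric]) (auto intro!: arg_cong[where f = card])
    finally have "(\<Sum>i<N. g (\<zeta> N i)) / real N \<le> real (card ?A) / real N" by (rule divide_right_mono) simp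
    then show ?case using elim by linarith
  qed
qed

text \<open>The upper bound comes from the lower bounds for the two complementary arcs, since the
  three frequencies add up to 1; each of the two arcs gets half of the slack,
  \<open>e\<close>.\<close>

lemma arc_frequency_tendsto:
  assumes "-pi \<le> \<theta>" "\<theta> \<le> \<phi>" "\<phi> \<le> pi"
  shows "(\<lambda>N. real (card {i. i < N \<and> \<theta> < Arg (\<zeta> N i) \<and> Arg (\<zeta> N i) \<le> \<phi>}) / real N)
    \<longlonglongrightarrow> (\<phi> - \<theta>) / (2 * pi)"
proof (rule order_tendstoI)
  fix c assume "c < (\<phi> - \<theta>) / (2 * pi)"
  then show "\<forall>\<^sub>F N in sequentially. c < real (card {i. i < N \<and> \<theta> < Arg (\<zeta> N i) \<and> Arg (\<zeta> N i) \<le> \<phi>}) / real N"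
    using arc_frequency_lower assms by blast
next
  fix c assume c: "(\<phi> - \<theta>) / (2 * pi) < c"
  define e where "e = (c - (\<phi> - \<theta>) / (2 * pi)) / 2"
  have "2 * e = c - (\<phi> - \<theta>) / (2 * pi)" unfolding e_def by simp
  then have e: "0 < e" "c = (\<phi> - \<theta>) / (2 * pi) + 2 * e" using c by auto
  have "\<forall>\<^sub>F N in sequentially. (\<theta> - (-pi)) / (2 * pi) - e
      < real (card {i. i < N \<and> -pi < Arg (\<zeta> N i) \<and> Arg (\<zeta> N i) \<le> \<theta>}) / real N"
    using assms e(1) by (intro arc_frequency_lower) auto
  moreover have "\<forall>\<^sub>F N in sequentially. (pi - \<phi>) / (2 * pi) - e
      < real (card {i. i < N \<and> \<phi> < Arg (\<zeta> N i) \<and> Arg (\<zeta> N i) \<le> pi}) / real N"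
    using assms e(1) by (intro arc_frequency_lower) auto
  moreover note eventually_gt_at_top[of "0::nat"]
  ultimately show "\<forall>\<^sub>F N in sequentially.
      real (card {i. i < N \<and> \<theta> < Arg (\<zeta> N i) \<and> Arg (\<zeta> N i) \<le> \<phi>}) / real N < c"
  proof eventually_elim
    case (elim N)
    let ?A = "{i. i < N \<and> -pi < Arg (\<zeta> N i) \<and> Arg (\<zeta> N i) \<le> \<theta>}"
    let ?B = "{i. i < N \<and> \<theta> < Arg (\<zeta> N i) \<and> Arg (\<zeta> N i) \<le> \<phi>}"
    let ?C = "{i. i < N \<and> \<phi> < Arg (\<zeta> N i) \<and> Arg (\<zeta> N i) \<le> pi}"
    have "card (?A \<union> ?B) = card ?A + card ?B" by (rule card_Un_disjoint) auto
    moreover have "card (?A \<union> ?B \<union> ?C) = card (?A \<union> ?B) + card ?C"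
      using assms by (intro card_Un_disjoint) auto
    ultimately have "card ?A + card ?B + card ?C = card (?A \<union> ?B \<union> ?C)" by simp
    also have "?A \<union> ?B \<union> ?C = {..<N}"
    proof -
      have "i \<in> ?A \<union> ?B \<union> ?C" if "i < N" for i
        using that mpi_less_Arg[of "\<zeta> N i"] Arg_le_pi[of "\<zeta> N i"]
        by (cases "Arg (\<zeta> N i) \<le> \<theta>"; cases "Arg (\<zeta> N i) \<le> \<phi>") auto
      then show ?thesis by blast
    qed
    finally have N: "card ?A + card ?B + card ?C = N" by (simp only: card_lessThan)
    have "real x / real N + real y / real N + real z / real N = 1" if "x + y + z = N" for x y z
      using that elim(3) by (auto simp flip: add_divide_distrib of_nat_add)
    from this[OF N]
    have sum1: "real (card ?A) / real N + real (card ?B) / real N + real (card ?C) / real N = 1" .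
    have sum2: "(\<theta> - (-pi)) / (2 * pi) + (\<phi> - \<theta>) / (2 * pi) + (pi - \<phi>) / (2 * pi) = 1"
      by (simp add: field_simps)
    have "y < c" if "x + y + z = 1" "p + q + r = 1" "p - e < x" "r - e < z" "c = q + 2 * e"
      for x y z p q r :: real using that by linarith
    from this[OF sum1 sum2 elim(1,2) e(2)] show ?case .
  qed
qed

end

section \<open>Equidistribution of the arguments of the zeros\<close>

text \<open>Each of the N + 1 summands is at most \<open>D * exp (e / 4 * real N)\<close>, where
  \<open>D\<close> takes care of the indices up to \<open>n0\<close>. The exponential costs e N / 4
  and the term ln (c N) half of that; \<open>ln (real N + 1)\<close> and the constants stay below e
  N / 2.\<close>

lemma log_ratio_sublinear:
  fixes c :: "nat \<Rightarrow> real"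
  assumes c: "\<And>n. 0 < c n" and lim: "(\<lambda>n. ln (c n) / real n) \<longlonglongrightarrow> 0" and e: "0 < e"
  shows "\<forall>\<^sub>F N in sequentially. ln (\<Sum>n\<le>N. c n) - (ln (c 0) + ln (c N)) / 2 < e * real N"
proof -
  obtain n0 where n0: "\<forall>n\<ge>n0. \<bar>ln (c n) / real n\<bar> < e / 4"
    using LIMSEQ_D[OF lim, of "e / 4"] e by auto
  define D where "D = 1 + (\<Sum>n\<le>n0. c n)"
  have D: "1 \<le> D" "c n \<le> D" if "n \<le> n0" for n
  proof -
    show "1 \<le> D" unfolding D_def using c by (simp add: sum_nonneg less_imp_le)
    have "c n \<le> (\<Sum>n\<le>n0. c n)" using that c by (intro member_le_sum) (auto simp: less_imp_le)
    then show "c n \<le> D" by (simp add: D_def)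
  qed
  have D1: "1 \<le> D" using D(1)[of 0] by simp
  have ln_c: "\<bar>ln (c n)\<bar> \<le> e / 4 * real n" if "n0 \<le> n" "0 < n" for n
  proof -
    have "\<bar>ln (c n)\<bar> / real n < e / 4" using n0[rule_format, OF that(1)] by simp
    then show ?thesis using that(2) by (simp add: divide_less_eq)
  qed
  have c_le: "c n \<le> D * exp (e / 4 * real N)" if "n \<le> N" for n N
  proof (cases "n \<le> n0")
    case True
    have "c n * 1 \<le> D * exp (e / 4 * real N)"
      using D(2)[OF True] D1 e c[of n] by (intro mult_mono) auto
    then show ?thesis by simp
  next
    case False
    then have "ln (c n) \<le> e / 4 * real n" using ln_c[of n] by auto
    also have "\<dots> \<le> e / 4 * real N" using that e by (intro mult_left_mono) auto
    finally have "exp (ln (c n)) \<le> exp (e / 4 * real N)" by (simp only: exp_le_cancel_iff)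
    then have "1 * c n \<le> D * exp (e / 4 * real N)"
      using c[of n] D1 by (intro mult_mono) auto
    then show ?thesis by simp
  qed
  define K where "K = ln D - ln (c 0) / 2"
  have "(\<lambda>N::nat. (ln (real N + 1) + K) / real N) \<longlonglongrightarrow> 0" by real_asymp
  then have "\<forall>\<^sub>F N in sequentially. (ln (real N + 1) + K) / real N < e / 2"
    using e by (intro order_tendstoD) auto
  moreover have "\<forall>\<^sub>F N::nat in sequentially. n0 \<le> N \<and> 0 < N"
    by (rule eventually_sequentiallyI[of "Suc n0"]) auto
  ultimately show ?thesis
  proof eventually_elim
    case (elim N)
    have "(\<Sum>n\<le>N. c n) \<le> (\<Sum>n\<le>N. D * exp (e / 4 * real N))" by (intro sum_mono c_le) simp
    also have "\<dots> = (real N + 1) * (D * exp (e / 4 * real N))" by (simp add: add.commute)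
    finally have "ln (\<Sum>n\<le>N. c n) \<le> ln ((real N + 1) * (D * exp (e / 4 * real N)))"
      using c D1 by (subst ln_le_cancel_iff) (auto intro!: sum_pos)
    also have "\<dots> = ln (real N + 1) + (ln D + e / 4 * real N)"
      using D1 by (simp add: ln_mult)
    finally have S: "ln (\<Sum>n\<le>N. c n) \<le> ln (real N + 1) + (ln D + e / 4 * real N)" .
    have L: "- ln (c N) \<le> e / 4 * real N" using ln_c[of N] elim(2) by auto
    have K: "ln (real N + 1) + (ln D - ln (c 0) / 2) < 2 * (e / 4 * real N)"
      using elim by (simp add: divide_less_eq K_def)
    have "s - (x + y) / 2 < 4 * w" if "s \<le> p + (q + w)" "- y \<le> w" "p + (q - x / 2) < 2 * w" "0 < w"
      for s x y p q w :: real using that by argo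
    from this[OF S L K] show ?case using e elim(2) by simp
  qed
qed

text \<open>Rescaling by \<open>R\<close> makes ln (b n * R ^ n) sublinear, so the bound of
  \<open>prod_cmod_diff_sgn_roots_le\<close> is exp (o(N)) and all power means of the normalised
  zeros tend to 0. Normalising a zero keeps its \<open>Arg\<close>.\<close>

lemma roots_equidistributed:
  fixes b :: "nat \<Rightarrow> real" and t :: "nat \<Rightarrow> nat \<Rightarrow> complex"
  assumes b: "\<And>n. 0 < b n" and lim: "(\<lambda>n. ln (b n) / real n) \<longlonglongrightarrow> l"
    and t: "\<And>N. (\<Sum>n\<le>N. monom (complex_of_real (b n)) n) = smult (of_real (b N)) (\<Prod>i<N. [:- t N i, 1:])"
    and arc: "-pi \<le> \<theta>" "\<theta> \<le> \<phi>" "\<phi> \<le> pi"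
  shows "(\<lambda>N. real (card {i. i < N \<and> \<theta> < Arg (t N i) \<and> Arg (t N i) \<le> \<phi>}) / real N)
    \<longlonglongrightarrow> (\<phi> - \<theta>) / (2 * pi)"
proof -
  define R where "R = exp (- l)"
  have R: "0 < R" by (simp add: R_def)
  have nz: "t N i \<noteq> 0" if "i < N" for N i
  proof
    assume "t N i = 0"
    then have "poly (\<Prod>i<N. [:- t N i, 1:]) 0 = 0" using that by (auto simp: poly_prod)
    then have "poly (\<Sum>n\<le>N. monom (complex_of_real (b n)) n) 0 = 0" unfolding t by simp
    then have "coeff (\<Sum>n\<le>N. monom (complex_of_real (b n)) n) 0 = 0" by (simp only: poly_0_coeff_0)
    then show False using b[of 0] by (simp add: coeff_sum)
  qed
  have unit: "cmod (sgn (t N i)) = 1" if "i < N" for N i using nz[OF that] by (simp add: norm_sgn)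
  define M where "M N = ln (\<Sum>n\<le>N. b n * R ^ n) - (ln (b 0) + ln (b N * R ^ N)) / 2" for N
  have "(\<lambda>n. ln (b n) / real n - l) \<longlonglongrightarrow> 0" using tendsto_diff[OF lim tendsto_const[of l]] by simp
  moreover have "\<forall>\<^sub>F n in sequentially. ln (b n) / real n - l = ln (b n * R ^ n) / real n"
  proof (rule eventually_sequentiallyI[of 1])
    fix n :: nat assume "1 \<le> n"
    moreover have "ln (b n * R ^ n) = ln (b n) - real n * l"
      using b[of n] R by (simp add: ln_mult ln_realpow) (simp add: R_def)
    ultimately show "ln (b n) / real n - l = ln (b n * R ^ n) / real n"
      by (simp add: diff_divide_distrib)
  qed
  ultimately have lim0: "(\<lambda>n. ln (b n * R ^ n) / real n) \<longlonglongrightarrow> 0"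
    using tendsto_cong by fastforce
  have M_less: "\<forall>\<^sub>F N in sequentially. M N < e * real N" if "0 < e" for e
    using log_ratio_sublinear[of "\<lambda>n. b n * R ^ n", OF _ lim0 that] b R by (simp add: M_def)
  interpret weyl_array "\<lambda>N i. sgn (t N i)"
  proof
    fix k :: nat assume "0 < k"
    then obtain j where k: "k = Suc j" by (cases k) auto
    \<comment> \<open>The constant of \<open>power_sum_le_of_prod_bound\<close>; with M' = e N / (2
      C) the power sum is at most e N / 2.\<close>
    define C where "C = 2 ^ (j + 2) * real (Suc j)"
    have C: "0 < C" by (simp add: C_def)
    show "(\<lambda>N. (\<Sum>i<N. sgn (t N i) ^ k) / of_nat N) \<longlonglongrightarrow> 0"
    proof (rule tendstoI)
      fix e :: real assume e: "0 < e"
      have "\<forall>\<^sub>F N in sequentially. M N < e / (2 * C) * real N"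
        by (rule M_less) (use e C in simp)
      then show "\<forall>\<^sub>F N in sequentially. dist ((\<Sum>i<N. sgn (t N i) ^ k) / of_nat N) 0 < e"
        using eventually_gt_at_top[of 0]
      proof eventually_elim
        case (elim N)
        have "cmod (\<Sum>i<N. sgn (t N i) ^ Suc j) \<le> 2 ^ (j + 2) * real (Suc j) * (e / (2 * C) * real N)"
        proof (rule power_sum_le_of_prod_bound[OF _ _ _ elim(1)])
          show "(\<Prod>i<N. cmod (u - sgn (t N i))) \<le> exp (M N)" if "cmod u = 1" for u
            unfolding M_def by (rule prod_cmod_diff_sgn_roots_le[OF b R that t])
        qed (use unit in auto)
        also have "\<dots> = C * (e / (2 * C) * real N)" by (simp only: C_def)
        also have "\<dots> = e / 2 * real N" using C by simp
        also have "\<dots> < e * real N" using e elim(2) by simp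
        finally show ?case using elim(2) by (simp add: k norm_divide divide_less_eq)
      qed
    qed
  qed (rule unit)
  have "Arg (sgn (t N i)) = Arg (t N i)" if "i < N" for N i
    using nz[OF that] by (simp add: sgn_eq)
  then have "{i. i < N \<and> \<theta> < Arg (sgn (t N i)) \<and> Arg (sgn (t N i)) \<le> \<phi>}
      = {i. i < N \<and> \<theta> < Arg (t N i) \<and> Arg (t N i) \<le> \<phi>}" for N
    by auto
  then show ?thesis using arc_frequency_tendsto[OF arc] by simp
qed

text \<open>The zeros are listed with multiplicity, as in \<open>proots\<close>. Positive
  coefficients make the degree of the partial sum exactly N, so each row has N entries.\<close>

lemma zero_arguments_equidistributed:
  fixes b :: "nat \<Rightarrow> real"
  assumes b: "\<And>n. 0 < b n" and lim: "(\<lambda>n. ln (b n) / real n) \<longlonglongrightarrow> l"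
    and arc: "-pi \<le> \<theta>" "\<theta> \<le> \<phi>" "\<phi> \<le> pi"
  shows "(\<lambda>N. real (size {#z \<in># proots (\<Sum>n\<le>N. monom (complex_of_real (b n)) n). \<theta> < Arg z \<and> Arg z \<le> \<phi>#})
      / real N) \<longlonglongrightarrow> (\<phi> - \<theta>) / (2 * pi)"
proof -
  define G where "G N = (\<Sum>n\<le>N. monom (complex_of_real (b n)) n)" for N
  have coeff: "coeff (G N) n = (if n \<le> N then of_real (b n) else 0)" for N n
    by (simp add: G_def coeff_sum)
  have deg: "degree (G N) = N" for N
  proof (rule antisym)
    show "degree (G N) \<le> N" by (rule degree_le) (simp add: coeff)
    show "N \<le> degree (G N)" using b[of N] by (intro le_degree) (simp add: coeff)
  qed
  obtain roots where roots: "\<And>N. mset (roots N) = proots (G N)"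
  proof -
    have "\<forall>N. \<exists>xs. mset xs = proots (G N)" using ex_mset by blast
    then show thesis using that by metis
  qed
  have len: "length (roots N) = N" for N
    using size_proots_complex[of "G N"] deg roots by (metis size_mset)
  have "G N = smult (of_real (b N)) (\<Prod>i<N. [:- (roots N ! i), 1:])" for N
  proof -
    have "G N = smult (lead_coeff (G N)) (\<Prod>x\<in>#mset (roots N). [:- x, 1:])"
      unfolding roots by (rule complex_poly_decompose_multiset[symmetric])
    also have "lead_coeff (G N) = of_real (b N)" by (simp add: deg coeff)
    also have "(\<Prod>x\<in>#mset (roots N). [:- x, 1:]) = (\<Prod>x\<leftarrow>roots N. [:- x, 1:])"
      by (subst prod_mset_prod_list[symmetric]) simp
    also have "\<dots> = (\<Prod>i<N. [:- (roots N ! i), 1:])"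
      by (simp add: prod.list_conv_set_nth atLeast0LessThan len)
    finally show ?thesis .
  qed
  then have "(\<lambda>N. real (card {i. i < N \<and> \<theta> < Arg (roots N ! i) \<and> Arg (roots N ! i) \<le> \<phi>}) / real N)
      \<longlonglongrightarrow> (\<phi> - \<theta>) / (2 * pi)"
    unfolding G_def by (rule roots_equidistributed[OF b lim _ arc])
  moreover have "size {#z \<in># proots (G N). \<theta> < Arg z \<and> Arg z \<le> \<phi>#}
      = card {i. i < N \<and> \<theta> < Arg (roots N ! i) \<and> Arg (roots N ! i) \<le> \<phi>}" for N
    unfolding roots[symmetric] mset_filter[symmetric] size_mset length_filter_conv_card len ..
  ultimately show ?thesis unfolding G_def by simp
qed

theorem theorem2p4:
  fixes d :: nat and a \<theta> \<phi> \<epsilon> :: real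
  assumes "d \<ge> 2" and "a > 0"
    and "-pi \<le> \<theta>" and "\<theta> < \<phi>" and "\<phi> \<le> pi" and "\<epsilon> > 0"
  shows "\<exists>N1\<ge>1. \<forall>N\<ge>N1.
           \<bar>real (alpha_count d a N \<theta> \<phi>) / real N - (\<phi> - \<theta>) / (2 * pi)\<bar> ^ 2 \<le> \<epsilon>"
proof -
  obtain l where "(\<lambda>n. ln (A_plus d n a) / real n) \<longlonglongrightarrow> l" and "\<And>n. 0 < A_plus d n a"
    using A_plus_growth_rate[OF assms(1,2)] by blast
  then have "(\<lambda>N. real (alpha_count d a N \<theta> \<phi>) / real N) \<longlonglongrightarrow> (\<phi> - \<theta>) / (2 * pi)"
    unfolding alpha_count_def G_poly_def
    using assms(3-5) by (intro zero_arguments_equidistributed) auto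
  \<comment> \<open>The tolerance is \<open>sqrt \<epsilon>\<close> because the claim bounds the
    square of the discrepancy.\<close>
  from LIMSEQ_D[OF this, of "sqrt \<epsilon>"] assms(6)
  obtain N0 where N0: "\<forall>N\<ge>N0. \<bar>real (alpha_count d a N \<theta> \<phi>) / real N - (\<phi> - \<theta>) / (2 * pi)\<bar> < sqrt \<epsilon>"
    by auto
  show ?thesis
  proof (intro exI[of _ "max 1 N0"] conjI allI impI)
    fix N assume "max 1 N0 \<le> N"
    then have "\<bar>real (alpha_count d a N \<theta> \<phi>) / real N - (\<phi> - \<theta>) / (2 * pi)\<bar> \<le> sqrt \<epsilon>"
      using N0 by (simp add: less_imp_le)
    then have "\<bar>real (alpha_count d a N \<theta> \<phi>) / real N - (\<phi> - \<theta>) / (2 * pi)\<bar> ^ 2 \<le> (sqrt \<epsilon>) ^ 2"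
      by (rule power_mono) simp
    then show "\<bar>real (alpha_count d a N \<theta> \<phi>) / real N - (\<phi> - \<theta>) / (2 * pi)\<bar> ^ 2 \<le> \<epsilon>"
      using assms(6) by simp
  qed simp
qed

end
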